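(* Let $(M,g)$ be a Riemannian manifold, let $\{(t_1,y_1),\ldots,(t_m,y_m)\}\subset\mathbb{R}\times M$ be a finite data set, and let $R\colon TM\to M$ be a retraction. For each $i$ let $U_{y_i}\subset T_{y_i}M$ and $D_{y_i}\subset M$ be open sets such that $R_{y_i}\colon U_{y_i}\to D_{y_i}$ is a diffeomorphism, with inverse $R_{y_i}^{-1}\colon D_{y_i}\to U_{y_i}$. Put $V_{y_i}:=\{(x,v)\in TM: R_x(t_iv)\in D_{y_i}\}$, $V:=\bigcap_{i=1}^mV_{y_i}$, and $$h_i\colon V_{y_i}\to T_{y_i}M,\qquad h_i(x,v):=R_{y_i}^{-1}\left(R_x(t_iv)\right).$$ Let $$\mathcal{F}_R\colon V\to[0,\infty),\qquad \mathcal{F}_R(x,v)=\frac12\sum_{i=1}^m g_{y_i}\left(h_i(x,v),h_i(x,v)\right).$$ Then the gradient of $\mathcal{F}_R$ with respect to the Sasaki metric $g^S$ on $TM$ is $$\mathrm{grad}\,\mathcal{F}_R(x,v)=\sum_{i=1}^m(\mathrm{d}h_i)^*_{(x,v)}\left(h_i(x,v)\right)\qquad\text{for all }(x,v)\in V,$$ where $(\mathrm{d}h_i)^*_{(x,v)}\colon T_{y_i}M\to T_{(x,v)}TM$ is the adjoint of $(\mathrm{d}h_i)_{(x,v)}\colon T_{(x,v)}TM\to T_{y_i}M$ with respect to the inner products $g^S_{(x,v)}$ on $T_{(x,v)}TM$ and $g_{y_i}$ on $T_{y_i}M$.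
   Context: A retraction on $M$ is a smooth map $R\colon TM\to M$ such that, with $R_x:=R|_{T_xM}$, for every $x\in M$ one has $R_x(0_x)=x$ and $(\mathrm{d}R_x)_{0_x}=\mathrm{id}_{T_xM}$ (identifying $T_{0_x}(T_xM)\simeq T_xM$). By the inverse function theorem, such sets $U_y, D_y$ exist for every $y\in M$. $M$ carries the Levi-Civita connection of $g$, with connector $K\colon T(TM)\to TM$; $\pi_M\colon TM\to M$ is the bundle projection. The Sasaki metric on $TM$ is $g^S_{(x,v)}(\xi,\eta)=g_x(\mathrm{d}\pi_M(\xi),\mathrm{d}\pi_M(\eta))+g_x(K(\xi),K(\eta))$ for $\xi,\eta\in T_{(x,v)}TM$. Each $V_{y_i}$ is open in $TM$, so $T_{(x,v)}V_{y_i}\simeq T_{(x,v)}TM$. The tangent spaces of the vector space $T_{y_i}M$ are identified with $T_{y_i}M$ itself. *)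

theory Defs
  imports "HOL-Analysis.Analysis" "HOL-Library.Function_Algebras"
begin

text \<open>
  Tangent vectors are families of vectors of the model space, so function types are made real
  vector spaces (pointwise operations).
\<close>

instantiation "fun" :: (type, scaleR) scaleR
begin
definition scaleR_fun :: "real \<Rightarrow> ('a \<Rightarrow> 'b) \<Rightarrow> 'a \<Rightarrow> 'b"
  where "scaleR_fun r f = (\<lambda>x. r *\<^sub>R f x)"
instance ..
end

lemma scaleR_fun_apply [simp]: "(r *\<^sub>R f) x = r *\<^sub>R f x"
  by (simp add: scaleR_fun_def)

instance "fun" :: (type, real_vector) real_vector
  by standard (simp_all add: fun_eq_iff scaleR_add_right scaleR_add_left)


section \<open>Smooth maps between open subsets of Euclidean spaces\<close>

primrec Ck_on ::
  "nat \<Rightarrow> 'a::euclidean_space set \<Rightarrow> ('a \<Rightarrow> 'b::euclidean_space) \<Rightarrow> bool" where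
  "Ck_on 0 S f \<longleftrightarrow> continuous_on S f"
| "Ck_on (Suc k) S f \<longleftrightarrow>
     (\<forall>x\<in>S. f differentiable (at x)) \<and>
     (\<forall>v. Ck_on k S (\<lambda>x. frechet_derivative f (at x) v))"

text \<open>Only used for open sets \<open>S\<close>.\<close>

definition smooth_on ::
  "'a::euclidean_space set \<Rightarrow> ('a \<Rightarrow> 'b::euclidean_space) \<Rightarrow> bool" where
  "smooth_on S f \<longleftrightarrow> (\<forall>k. Ck_on k S f)"


section \<open>Smooth manifolds\<close>

text \<open>
  A manifold modelled on \<open>'e\<close> is given by an atlas (not necessarily maximal); its underlying set
  is the union of the chart domains and its topology is the one induced by the charts. A chart is
  a pair of its domain and its coordinate map; the values of the latter outside the domain are
  irrelevant.
\<close>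

type_synonym ('a, 'e) chart = "'a set \<times> ('a \<Rightarrow> 'e)"

definition chart_inv :: "('a, 'e) chart \<Rightarrow> 'e \<Rightarrow> 'a" where
  "chart_inv c = inv_into (fst c) (snd c)"

definition carrier :: "('a, 'e) chart set \<Rightarrow> 'a set" where
  "carrier A = (\<Union>c\<in>A. fst c)"

definition charts_at :: "('a, 'e) chart set \<Rightarrow> 'a \<Rightarrow> ('a, 'e) chart set" where
  "charts_at A p = {c \<in> A. p \<in> fst c}"

definition atlas_topology :: "('a, 'e::euclidean_space) chart set \<Rightarrow> 'a topology" where
  "atlas_topology A =
     topology (\<lambda>W. W \<subseteq> carrier A \<and> (\<forall>c\<in>A. open (snd c ` (W \<inter> fst c))))"

definition smooth_atlas :: "('a, 'e::euclidean_space) chart set \<Rightarrow> bool" where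
  "smooth_atlas A \<longleftrightarrow>
     (\<forall>c\<in>A. inj_on (snd c) (fst c) \<and> open (snd c ` fst c)) \<and>
     (\<forall>c\<in>A. \<forall>d\<in>A. open (snd c ` (fst c \<inter> fst d)) \<and>
        smooth_on (snd c ` (fst c \<inter> fst d)) (snd d \<circ> chart_inv c))"

definition second_countable_topology_on :: "'a topology \<Rightarrow> bool" where
  "second_countable_topology_on X \<longleftrightarrow>
     (\<exists>\<B>. countable \<B> \<and> (\<forall>B\<in>\<B>. openin X B) \<and>
        (\<forall>W p. openin X W \<and> p \<in> W \<longrightarrow> (\<exists>B\<in>\<B>. p \<in> B \<and> B \<subseteq> W)))"

definition smooth_manifold :: "('a, 'e::euclidean_space) chart set \<Rightarrow> bool" where
  "smooth_manifold A \<longleftrightarrow>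
     smooth_atlas A \<and>
     Hausdorff_space (atlas_topology A) \<and>
     second_countable_topology_on (atlas_topology A)"

lemma openin_atlas_topology:
  assumes "\<And>c. c \<in> A \<Longrightarrow> inj_on (snd c) (fst c)"
  shows "openin (atlas_topology A) W \<longleftrightarrow>
           W \<subseteq> carrier A \<and> (\<forall>c\<in>A. open (snd c ` (W \<inter> fst c)))"
proof -
  have "istopology (\<lambda>W. W \<subseteq> carrier A \<and> (\<forall>c\<in>A. open (snd c ` (W \<inter> fst c))))"
    unfolding istopology_def
  proof (intro conjI allI impI ballI)
    fix S T c
    assume S: "S \<subseteq> carrier A \<and> (\<forall>c\<in>A. open (snd c ` (S \<inter> fst c)))"
      and T: "T \<subseteq> carrier A \<and> (\<forall>c\<in>A. open (snd c ` (T \<inter> fst c)))"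
    show "S \<inter> T \<subseteq> carrier A" using S by blast
    assume c: "c \<in> A"
    have "snd c ` (S \<inter> T \<inter> fst c) = snd c ` (S \<inter> fst c) \<inter> snd c ` (T \<inter> fst c)"
      using assms[OF c] by (auto simp: inj_on_def)
    then show "open (snd c ` (S \<inter> T \<inter> fst c))" using S T c by auto
  next
    fix \<K>
    assume K: "\<forall>S\<in>\<K>. S \<subseteq> carrier A \<and> (\<forall>c\<in>A. open (snd c ` (S \<inter> fst c)))"
    then show "\<Union>\<K> \<subseteq> carrier A" by blast
    fix c assume c: "c \<in> A"
    have "snd c ` (\<Union>\<K> \<inter> fst c) = (\<Union>S\<in>\<K>. snd c ` (S \<inter> fst c))" by blast
    then show "open (snd c ` (\<Union>\<K> \<inter> fst c))" using K c by auto
  qed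
  then show ?thesis by (simp add: atlas_topology_def)
qed

definition smooth_map_on ::
  "('a, 'e::euclidean_space) chart set \<Rightarrow> 'a set \<Rightarrow> ('b, 'f::euclidean_space) chart set
     \<Rightarrow> ('a \<Rightarrow> 'b) \<Rightarrow> bool" where
  "smooth_map_on A W B f \<longleftrightarrow>
     openin (atlas_topology A) W \<and>
     f ` W \<subseteq> carrier B \<and>
     continuous_map (subtopology (atlas_topology A) W) (atlas_topology B) f \<and>
     (\<forall>c\<in>A. \<forall>d\<in>B. smooth_on (snd c ` (fst c \<inter> W \<inter> f -` fst d)) (snd d \<circ> f \<circ> chart_inv c))"

definition diffeomorphism_on ::
  "('a, 'e::euclidean_space) chart set \<Rightarrow> 'a set \<Rightarrow> ('b, 'f::euclidean_space) chart set
     \<Rightarrow> 'b set \<Rightarrow> ('a \<Rightarrow> 'b) \<Rightarrow> bool" where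
  "diffeomorphism_on A U B D f \<longleftrightarrow>
     bij_betw f U D \<and> smooth_map_on A U B f \<and> smooth_map_on B D A (the_inv_into U f)"


section \<open>Tangent spaces, tangent bundle, differentials\<close>

text \<open>
  A tangent vector at \<open>p\<close> assigns to every chart around \<open>p\<close> its coordinate vector, transforming
  by the derivatives of the chart transitions; it is \<open>0\<close> on all other arguments, so that tangent
  vectors at \<open>p\<close> are equal iff they are equal as functions.
\<close>

type_synonym ('a, 'e) tvec = "('a, 'e) chart \<Rightarrow> 'e"
type_synonym ('a, 'e) tpoint = "'a \<times> ('a, 'e) tvec"

definition tangent_space ::
  "('a, 'e::euclidean_space) chart set \<Rightarrow> 'a \<Rightarrow> ('a, 'e) tvec set" where
  "tangent_space A p =
     {v. (\<forall>c. c \<notin> charts_at A p \<longrightarrow> v c = 0) \<and>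
         (\<forall>c\<in>charts_at A p. \<forall>d\<in>charts_at A p.
            v d = frechet_derivative (snd d \<circ> chart_inv c) (at (snd c p)) (v c))}"

definition tangent_bundle ::
  "('a, 'e::euclidean_space) chart set \<Rightarrow> ('a, 'e) tpoint set" where
  "tangent_bundle A = Sigma (carrier A) (tangent_space A)"

definition tangent_chart ::
  "('a, 'e::euclidean_space) chart set \<Rightarrow> ('a, 'e) chart \<Rightarrow> (('a, 'e) tpoint, 'e \<times> 'e) chart"
where
  "tangent_chart A c = (Sigma (fst c) (tangent_space A), \<lambda>(p, v). (snd c p, v c))"

definition tangent_atlas ::
  "('a, 'e::euclidean_space) chart set \<Rightarrow> (('a, 'e) tpoint, 'e \<times> 'e) chart set" where
  "tangent_atlas A = tangent_chart A ` A"

text \<open>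
  The source coordinates are taken in an arbitrary chart around the point; by the chain rule the
  result does not depend on it if \<open>f\<close> is smooth near \<open>p\<close> and \<open>v\<close> is tangent at \<open>p\<close>.
\<close>

definition some_chart :: "('a, 'e) chart set \<Rightarrow> 'a \<Rightarrow> ('a, 'e) chart" where
  "some_chart A p = (SOME c. c \<in> charts_at A p)"

definition differential ::
  "('a, 'e::euclidean_space) chart set \<Rightarrow> ('b, 'f::euclidean_space) chart set
     \<Rightarrow> ('a \<Rightarrow> 'b) \<Rightarrow> 'a \<Rightarrow> ('a, 'e) tvec \<Rightarrow> ('b, 'f) tvec" where
  "differential A B f p v =
     (let c = some_chart A p in
        (\<lambda>d. if d \<in> charts_at B (f p)
             then frechet_derivative (snd d \<circ> f \<circ> chart_inv c) (at (snd c p)) (v c)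
             else 0))"

definition function_differential ::
  "('a, 'e::euclidean_space) chart set \<Rightarrow> ('a \<Rightarrow> real) \<Rightarrow> 'a \<Rightarrow> ('a, 'e) tvec \<Rightarrow> real" where
  "function_differential A f p v =
     (let c = some_chart A p in frechet_derivative (f \<circ> chart_inv c) (at (snd c p)) (v c))"


section \<open>The tangent space as a manifold\<close>

text \<open>The charts of \<open>T\<^sub>yM\<close> are the linear isomorphisms onto \<open>'e\<close> given by the charts around \<open>y\<close>.\<close>

definition fiber_atlas ::
  "('a, 'e::euclidean_space) chart set \<Rightarrow> 'a \<Rightarrow> (('a, 'e) tvec, 'e) chart set" where
  "fiber_atlas A y = (\<lambda>c. (tangent_space A y, \<lambda>v. v c)) ` charts_at A y"

text \<open>
  The identification of \<open>T\<^sub>yM\<close> with its tangent space at any of its points. As the charts of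
  \<open>T\<^sub>yM\<close> are linear, the coordinate of \<open>u\<close> in such a chart is the value of the chart at \<open>u\<close>.
\<close>

definition to_fiber_tangent ::
  "('a, 'e::euclidean_space) chart set \<Rightarrow> 'a \<Rightarrow> ('a, 'e) tvec \<Rightarrow> (('a, 'e) tvec, 'e) tvec" where
  "to_fiber_tangent A y u = (\<lambda>d. if d \<in> fiber_atlas A y then snd d u else 0)"

definition of_fiber_tangent ::
  "('a, 'e::euclidean_space) chart set \<Rightarrow> 'a \<Rightarrow> (('a, 'e) tvec, 'e) tvec \<Rightarrow> ('a, 'e) tvec" where
  "of_fiber_tangent A y = the_inv_into (tangent_space A y) (to_fiber_tangent A y)"


section \<open>Riemannian metrics\<close>

definition inner_product_on :: "'v::real_vector set \<Rightarrow> ('v \<Rightarrow> 'v \<Rightarrow> real) \<Rightarrow> bool" where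
  "inner_product_on S B \<longleftrightarrow>
     (\<forall>u\<in>S. \<forall>v\<in>S. B u v = B v u) \<and>
     (\<forall>u\<in>S. \<forall>v\<in>S. \<forall>w\<in>S. B (u + v) w = B u w + B v w) \<and>
     (\<forall>r. \<forall>u\<in>S. \<forall>v\<in>S. B (r *\<^sub>R u) v = r * B u v) \<and>
     (\<forall>u\<in>S. u \<noteq> 0 \<longrightarrow> B u u > 0)"

type_synonym ('a, 'e) metric = "'a \<Rightarrow> ('a, 'e) tvec \<Rightarrow> ('a, 'e) tvec \<Rightarrow> real"

definition vector_of_coords ::
  "('a, 'e::euclidean_space) chart set \<Rightarrow> ('a, 'e) chart \<Rightarrow> 'a \<Rightarrow> 'e \<Rightarrow> ('a, 'e) tvec" where
  "vector_of_coords A c p a = (THE v. v \<in> tangent_space A p \<and> v c = a)"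

definition riemannian_manifold ::
  "('a, 'e::euclidean_space) chart set \<Rightarrow> ('a, 'e) metric \<Rightarrow> bool" where
  "riemannian_manifold A g \<longleftrightarrow>
     smooth_manifold A \<and>
     (\<forall>p\<in>carrier A. inner_product_on (tangent_space A p) (g p)) \<and>
     (\<forall>c\<in>A. \<forall>a b. smooth_on (snd c ` fst c)
        (\<lambda>z. let p = chart_inv c z in g p (vector_of_coords A c p a) (vector_of_coords A c p b)))"

definition gradient ::
  "('a, 'e::euclidean_space) chart set \<Rightarrow> ('a, 'e) metric \<Rightarrow> ('a \<Rightarrow> real) \<Rightarrow> 'a \<Rightarrow> ('a, 'e) tvec"
where
  "gradient A g f p =
     (THE w. w \<in> tangent_space A p \<and>
        (\<forall>v\<in>tangent_space A p. g p w v = function_differential A f p v))"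

definition adjoint_on ::
  "'v set \<Rightarrow> ('v \<Rightarrow> 'v \<Rightarrow> real) \<Rightarrow> 'w set \<Rightarrow> ('w \<Rightarrow> 'w \<Rightarrow> real) \<Rightarrow> ('v \<Rightarrow> 'w) \<Rightarrow> 'w \<Rightarrow> 'v" where
  "adjoint_on S B T C L u =
     (if u \<in> T then (THE v. v \<in> S \<and> (\<forall>x\<in>S. B v x = C u (L x))) else undefined)"


section \<open>Levi-Civita connector and Sasaki metric\<close>

definition smooth_vector_field ::
  "('a, 'e::euclidean_space) chart set \<Rightarrow> ('a \<Rightarrow> ('a, 'e) tvec) \<Rightarrow> bool" where
  "smooth_vector_field A X \<longleftrightarrow>
     (\<forall>p\<in>carrier A. X p \<in> tangent_space A p) \<and>
     smooth_map_on A (carrier A) (tangent_atlas A) (\<lambda>p. (p, X p))"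

definition lie_bracket ::
  "('a, 'e::euclidean_space) chart set \<Rightarrow> ('a \<Rightarrow> ('a, 'e) tvec) \<Rightarrow> ('a \<Rightarrow> ('a, 'e) tvec)
     \<Rightarrow> 'a \<Rightarrow> ('a, 'e) tvec" where
  "lie_bracket A X Y p =
     (\<lambda>c. if c \<in> charts_at A p
          then frechet_derivative (\<lambda>z. Y (chart_inv c z) c) (at (snd c p)) (X p c)
             - frechet_derivative (\<lambda>z. X (chart_inv c z) c) (at (snd c p)) (Y p c)
          else 0)"

definition vertical_lift ::
  "('a, 'e::euclidean_space) chart set \<Rightarrow> ('a, 'e) tpoint \<Rightarrow> ('a, 'e) tvec
     \<Rightarrow> (('a, 'e) tpoint, 'e \<times> 'e) tvec" where
  "vertical_lift A P w =
     differential (fiber_atlas A (fst P)) (tangent_atlas A) (\<lambda>v. (fst P, v)) (snd P)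
       (to_fiber_tangent A (fst P) w)"

definition fiber_scale :: "real \<Rightarrow> ('a, 'e::real_vector) tpoint \<Rightarrow> ('a, 'e) tpoint" where
  "fiber_scale r P = (fst P, r *\<^sub>R snd P)"

text \<open>
  A connector \<open>K : T(TM) \<rightarrow> TM\<close> is a smooth map that is a left inverse of the vertical lift and
  linear for both vector bundle structures of \<open>T(TM)\<close> over \<open>TM\<close>. Linearity for the second one,
  whose projection is the differential of \<open>\<pi>\<close>, is expressed by homogeneity with respect to its
  fibrewise scalar multiplication, the differential of scalar multiplication on \<open>TM\<close> (a smooth
  map between vector spaces that is homogeneous of degree one is linear).
\<close>

type_synonym ('a, 'e) connector_map = "(('a, 'e) tpoint, 'e \<times> 'e) tpoint \<Rightarrow> ('a, 'e) tpoint"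

definition connector ::
  "('a, 'e::euclidean_space) chart set \<Rightarrow> ('a, 'e) connector_map \<Rightarrow> bool" where
  "connector A K \<longleftrightarrow>
     smooth_map_on (tangent_atlas (tangent_atlas A)) (tangent_bundle (tangent_atlas A))
       (tangent_atlas A) K \<and>
     (\<forall>P\<in>tangent_bundle A. \<forall>\<xi>\<in>tangent_space (tangent_atlas A) P.
        fst (K (P, \<xi>)) = fst P \<and>
        (\<forall>\<eta>\<in>tangent_space (tangent_atlas A) P.
           snd (K (P, \<xi> + \<eta>)) = snd (K (P, \<xi>)) + snd (K (P, \<eta>))) \<and>
        (\<forall>r. snd (K (P, r *\<^sub>R \<xi>)) = r *\<^sub>R snd (K (P, \<xi>))) \<and>
        (\<forall>r. K (fiber_scale r P,
                differential (tangent_atlas A) (tangent_atlas A) (fiber_scale r) P \<xi>)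
              = fiber_scale r (K (P, \<xi>)))) \<and>
     (\<forall>P\<in>tangent_bundle A. \<forall>w\<in>tangent_space A (fst P).
        K (P, vertical_lift A P w) = (fst P, w))"

text \<open>The covariant derivative of the connection with connector \<open>K\<close>: \<open>\<nabla>\<^sub>X Y = K \<circ> dY \<circ> X\<close>.\<close>

definition covariant_derivative ::
  "('a, 'e::euclidean_space) chart set \<Rightarrow> ('a, 'e) connector_map
     \<Rightarrow> ('a \<Rightarrow> ('a, 'e) tvec) \<Rightarrow> ('a \<Rightarrow> ('a, 'e) tvec) \<Rightarrow> 'a \<Rightarrow> ('a, 'e) tvec" where
  "covariant_derivative A K X Y p =
     snd (K ((p, Y p), differential A (tangent_atlas A) (\<lambda>q. (q, Y q)) p (X p)))"

definition levi_civita_connector ::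
  "('a, 'e::euclidean_space) chart set \<Rightarrow> ('a, 'e) metric \<Rightarrow> ('a, 'e) connector_map \<Rightarrow> bool" where
  "levi_civita_connector A g K \<longleftrightarrow>
     connector A K \<and>
     (\<forall>X Y. smooth_vector_field A X \<and> smooth_vector_field A Y \<longrightarrow>
        (\<forall>p\<in>carrier A.
           covariant_derivative A K X Y p - covariant_derivative A K Y X p
             = lie_bracket A X Y p)) \<and>
     (\<forall>X Y Z. smooth_vector_field A X \<and> smooth_vector_field A Y \<and> smooth_vector_field A Z \<longrightarrow>
        (\<forall>p\<in>carrier A.
           function_differential A (\<lambda>q. g q (Y q) (Z q)) p (X p)
             = g p (covariant_derivative A K X Y p) (Z p)
             + g p (Y p) (covariant_derivative A K X Z p)))"

definition sasaki_metric ::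
  "('a, 'e::euclidean_space) chart set \<Rightarrow> ('a, 'e) metric \<Rightarrow> ('a, 'e) connector_map
     \<Rightarrow> (('a, 'e) tpoint, 'e \<times> 'e) metric" where
  "sasaki_metric A g K P \<xi> \<eta> =
     g (fst P) (differential (tangent_atlas A) A fst P \<xi>) (differential (tangent_atlas A) A fst P \<eta>)
     + g (fst P) (snd (K (P, \<xi>))) (snd (K (P, \<eta>)))"


section \<open>Retractions and the least-squares functional\<close>

definition manifold_retraction ::
  "('a, 'e::euclidean_space) chart set \<Rightarrow> (('a, 'e) tpoint \<Rightarrow> 'a) \<Rightarrow> bool" where
  "manifold_retraction A R \<longleftrightarrow>
     smooth_map_on (tangent_atlas A) (tangent_bundle A) A R \<and>
     (\<forall>x\<in>carrier A.
        R (x, 0) = x \<and>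
        (\<forall>u\<in>tangent_space A x.
           differential (fiber_atlas A x) A (\<lambda>v. R (x, v)) 0 (to_fiber_tangent A x u) = u))"

definition V_dom ::
  "('a, 'e::euclidean_space) chart set \<Rightarrow> (('a, 'e) tpoint \<Rightarrow> 'a) \<Rightarrow> real \<Rightarrow> 'a set
     \<Rightarrow> ('a, 'e) tpoint set" where
  "V_dom A R t D = {(x, v) \<in> tangent_bundle A. R (x, t *\<^sub>R v) \<in> D}"

definition h_map ::
  "(('a, 'e::euclidean_space) tpoint \<Rightarrow> 'a) \<Rightarrow> real \<Rightarrow> 'a \<Rightarrow> ('a, 'e) tvec set
     \<Rightarrow> ('a, 'e) tpoint \<Rightarrow> ('a, 'e) tvec" where
  "h_map R t y U = (\<lambda>(x, v). the_inv_into U (\<lambda>w. R (y, w)) (R (x, t *\<^sub>R v)))"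

definition dh_map ::
  "('a, 'e::euclidean_space) chart set \<Rightarrow> (('a, 'e) tpoint \<Rightarrow> 'a) \<Rightarrow> real \<Rightarrow> 'a \<Rightarrow> ('a, 'e) tvec set
     \<Rightarrow> ('a, 'e) tpoint \<Rightarrow> (('a, 'e) tpoint, 'e \<times> 'e) tvec \<Rightarrow> ('a, 'e) tvec" where
  "dh_map A R t y U P \<xi> =
     of_fiber_tangent A y (differential (tangent_atlas A) (fiber_atlas A y) (h_map R t y U) P \<xi>)"

definition F_fun ::
  "('a, 'e::euclidean_space) metric \<Rightarrow> (('a, 'e) tpoint \<Rightarrow> 'a) \<Rightarrow> nat \<Rightarrow> (nat \<Rightarrow> real) \<Rightarrow> (nat \<Rightarrow> 'a)
     \<Rightarrow> (nat \<Rightarrow> ('a, 'e) tvec set) \<Rightarrow> ('a, 'e) tpoint \<Rightarrow> real" where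
  "F_fun g R m t y U P =
     1 / 2 * (\<Sum>i = 1..m. g (y i) (h_map R (t i) (y i) (U i) P) (h_map R (t i) (y i) (U i) P))"

end

theory Submission
  imports Defs
begin

text \<open>
  Each \<open>h\<^sub>i\<close> takes values in the single vector space \<open>T\<^bsub>y\<^sub>i\<^esub>M\<close> with its constant inner product, so the
  product rule gives \<open>d\<F>(\<xi>) = \<Sum>\<^sub>i g(h\<^sub>i, dh\<^sub>i \<xi>)\<close> without derivatives of the metric. By the
  definition of the adjoint this is \<open>g\<^sup>S(\<Sum>\<^sub>i (dh\<^sub>i)\<^sup>* h\<^sub>i, \<xi>)\<close>, and a vector is determined by the
  functional it represents (\<open>gradient_sum_of_squares\<close>). Three things make this meaningful.

  Adjoint and gradient are defined by unique descriptions, so representing vectors have to exist: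
  this is the finite-dimensional Riesz theorem \<open>inner_product_on_represents\<close>, transported to a
  tangent space by the coordinates of a chart.

  The Sasaki metric has to be an inner product on every \<open>T\<^bsub>(x,v)\<^esub>TM\<close>
  (\<open>inner_product_on_sasaki_metric\<close>). It is definite because the kernel of \<open>d\<pi>\<close> consists of
  vertical lifts, on which the connector is injective.

  Each \<open>h\<^sub>i\<close> has to be differentiable on \<open>V\<close> (\<open>differentiable_h_map\<close>), being the composition of
  a fibrewise scaling, the retraction and the inverse of the diffeomorphism \<open>R\<^bsub>y\<^sub>i\<^esub>\<close>. The
  chain rule for maps between atlases yields this, once \<open>TM\<close> is known to have differentiable
  transitions (\<open>differentiable_atlas_tangent_atlas\<close>).
\<close>


section \<open>Representing linear functionals\<close>

text \<open>
  The coordinate map \<open>\<phi>\<close> makes \<open>S\<close> finite-dimensional, so that the injective map sending a vector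
  to the functional it represents is also surjective.
\<close>

lemma inner_product_on_represents:
  fixes S :: "'v::real_vector set" and \<phi> :: "'f::euclidean_space \<Rightarrow> 'v" and L :: "'v \<Rightarrow> real"
  assumes ip: "inner_product_on S B" and lin: "linear \<phi>" and bij: "bij_betw \<phi> UNIV S"
    and L: "linear (\<lambda>a. L (\<phi> a))"
  shows "\<exists>!v. v \<in> S \<and> (\<forall>x\<in>S. B v x = L x)"
proof -
  have S: "\<phi> a \<in> S" for a using bij by (auto simp: bij_betw_def)
  have inj: "inj \<phi>" using bij by (auto simp: bij_betw_def)
  have sym: "B u v = B v u" if "u \<in> S" "v \<in> S" for u v
    using ip that by (auto simp: inner_product_on_def)
  have add: "B (u + v) w = B u w + B v w" if "u \<in> S" "v \<in> S" "w \<in> S" for u v w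
    using ip that by (auto simp: inner_product_on_def)
  have scale: "B (r *\<^sub>R u) v = r * B u v" if "u \<in> S" "v \<in> S" for r u v
    using ip that by (auto simp: inner_product_on_def)
  have linl: "linear (\<lambda>a. B (\<phi> a) (\<phi> b))" for b
    by (rule linearI) (simp_all add: linear_add[OF lin] linear_scale[OF lin] add scale S)
  have linr: "linear (\<lambda>b. B (\<phi> a) (\<phi> b))" for a
    using linl[of a] by (simp add: sym[OF S S])
  have pos: "B (\<phi> a) (\<phi> a) > 0" if "a \<noteq> 0" for a
  proof -
    have "\<phi> a \<noteq> 0" using that inj linear_0[OF lin] by (metis injD)
    then show ?thesis using ip S by (auto simp: inner_product_on_def)
  qed
  \<comment> \<open>the functional \<open>B (\<phi> a) \<circ> \<phi>\<close>, written as a vector by means of the Euclidean inner product\<close>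
  define T where "T a = (\<Sum>b\<in>Basis. B (\<phi> a) (\<phi> b) *\<^sub>R b)" for a
  have represent: "linear f \<Longrightarrow> f x = (\<Sum>b\<in>Basis. f b *\<^sub>R b) \<bullet> x" for f :: "'f \<Rightarrow> real" and x
  proof -
    assume f: "linear f"
    have "f x = f (\<Sum>b\<in>Basis. (x \<bullet> b) *\<^sub>R b)" by (simp add: euclidean_representation)
    also have "\<dots> = (\<Sum>b\<in>Basis. (x \<bullet> b) * f b)"
      by (simp add: linear_sum[OF f] linear_scale[OF f])
    also have "\<dots> = (\<Sum>b\<in>Basis. f b *\<^sub>R b) \<bullet> x"
      by (simp add: inner_sum_left inner_commute[of x] mult.commute)
    finally show ?thesis .
  qed
  have T: "T a \<bullet> x = B (\<phi> a) (\<phi> x)" for a x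
    unfolding T_def by (rule represent[OF linr, symmetric])
  have linT: "linear T"
    by (rule linearI) (simp_all add: T_def linear_add[OF linl] linear_scale[OF linl]
        scaleR_add_left sum.distrib scaleR_sum_right)
  have "inj T"
  proof (subst linear_injective_0[OF linT], intro allI impI)
    fix a assume "T a = 0"
    then have "B (\<phi> a) (\<phi> a) = 0" using T[of a a] by simp
    then show "a = 0" using pos[of a] by fastforce
  qed
  then have "surj T" using linT by (simp add: linear_injective_imp_surjective)
  then obtain a where a: "T a = (\<Sum>b\<in>Basis. L (\<phi> b) *\<^sub>R b)" by (metis surjD)
  have ex: "B (\<phi> a) x = L x" if x: "x \<in> S" for x
  proof -
    obtain b where "x = \<phi> b" using bij_betw_imp_surj_on[OF bij] x by blast
    then show ?thesis using T[of a b] represent[OF L, of b] a by simp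
  qed
  show ?thesis
  proof (rule ex1I[of _ "\<phi> a"])
    show "\<phi> a \<in> S \<and> (\<forall>x\<in>S. B (\<phi> a) x = L x)" using ex S by blast
    fix v assume v: "v \<in> S \<and> (\<forall>x\<in>S. B v x = L x)"
    then obtain b where b: "v = \<phi> b" using bij_betw_imp_surj_on[OF bij] by blast
    have "T b \<bullet> x = T a \<bullet> x" for x using v b ex S T by metis
    then have "T b = T a" by (metis euclidean_eqI)
    then show "v = \<phi> a" using \<open>inj T\<close> b by (metis injD)
  qed
qed


section \<open>Atlases with differentiable transitions\<close>

text \<open>
  First derivatives are all that tangent spaces and differentials use, and this weaker notion
  passes from a smooth atlas to the tangent atlas without an induction on the order of
  differentiability.
\<close>

definition differentiable_atlas :: "('a, 'e::euclidean_space) chart set \<Rightarrow> bool" where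
  "differentiable_atlas A \<longleftrightarrow>
     (\<forall>c\<in>A. inj_on (snd c) (fst c)) \<and>
     (\<forall>c\<in>A. \<forall>d\<in>A. open (snd c ` (fst c \<inter> fst d)) \<and>
        (\<forall>p\<in>fst c \<inter> fst d. (snd d \<circ> chart_inv c) differentiable (at (snd c p))))"

lemma differentiable_atlasD:
  assumes "differentiable_atlas A"
  shows "c \<in> A \<Longrightarrow> inj_on (snd c) (fst c)"
    and "c \<in> A \<Longrightarrow> d \<in> A \<Longrightarrow> open (snd c ` (fst c \<inter> fst d))"
    and "c \<in> charts_at A p \<Longrightarrow> d \<in> charts_at A p \<Longrightarrow>
           (snd d \<circ> chart_inv c) differentiable (at (snd c p))"
  using assms by (auto simp: differentiable_atlas_def charts_at_def)

lemma smooth_on_imp_differentiable: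
  "smooth_on S f \<Longrightarrow> x \<in> S \<Longrightarrow> f differentiable (at x)"
  unfolding smooth_on_def by (drule spec[of _ "Suc 0"]) simp

lemma smooth_on_imp_derivative_differentiable:
  "smooth_on S f \<Longrightarrow> x \<in> S \<Longrightarrow> (\<lambda>x. frechet_derivative f (at x) v) differentiable (at x)"
  unfolding smooth_on_def by (drule spec[of _ "Suc (Suc 0)"]) simp

lemma smooth_atlas_imp_differentiable_atlas:
  assumes "smooth_atlas A"
  shows "differentiable_atlas A"
  using assms
  by (auto simp: smooth_atlas_def differentiable_atlas_def intro!: smooth_on_imp_differentiable)

lemma chart_inv_chart:
  assumes "differentiable_atlas A" and "c \<in> A" and "q \<in> fst c"
  shows "chart_inv c (snd c q) = q"
  using assms by (simp add: chart_inv_def differentiable_atlas_def)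

lemma eventually_in_overlap:
  assumes A: "differentiable_atlas A" and "c \<in> charts_at A p" and "d \<in> charts_at A p"
  shows "\<forall>\<^sub>F z in nhds (snd c p).
           chart_inv c z \<in> fst c \<and> chart_inv c z \<in> fst d \<and> snd c (chart_inv c z) = z"
proof -
  have "\<forall>\<^sub>F z in nhds (snd c p). z \<in> snd c ` (fst c \<inter> fst d)"
    using assms by (intro eventually_nhds_in_open) (auto simp: differentiable_atlas_def charts_at_def)
  then show ?thesis
    by (rule eventually_mono) (use assms in \<open>auto simp: charts_at_def chart_inv_chart[OF A]\<close>)
qed

lemma has_derivative_cong_nhds:
  fixes f h :: "'u::real_normed_vector \<Rightarrow> 'w::real_normed_vector"
  assumes "(f has_derivative f') (at x)" and "\<forall>\<^sub>F z in nhds x. f z = h z"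
  shows "(h has_derivative f') (at x)"
  using assms has_derivative_transform_eventually[of f f' x UNIV h]
    eventually_nhds_x_imp_x[OF assms(2)]
  by (auto simp: eventually_nhds_conv_at)

text \<open>
  The first condition expresses continuity of \<open>f\<close> at \<open>p\<close>, as far as it is needed for the
  coordinate expressions of a composition to compose near \<open>p\<close>.
\<close>

definition differentiable_map_at ::
  "('a, 'e::euclidean_space) chart set \<Rightarrow> ('b, 'f::euclidean_space) chart set
     \<Rightarrow> ('a \<Rightarrow> 'b) \<Rightarrow> 'a \<Rightarrow> bool" where
  "differentiable_map_at A B f p \<longleftrightarrow>
     (\<forall>c\<in>charts_at A p. \<forall>d\<in>charts_at B (f p).
        (\<forall>\<^sub>F z in nhds (snd c p). f (chart_inv c z) \<in> fst d) \<and>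
        (snd d \<circ> f \<circ> chart_inv c) differentiable (at (snd c p)))"

lemma differentiable_map_atD:
  assumes "differentiable_map_at A B f p" and "c \<in> charts_at A p" and "d \<in> charts_at B (f p)"
  shows "\<forall>\<^sub>F z in nhds (snd c p). f (chart_inv c z) \<in> fst d"
    and "(snd d \<circ> f \<circ> chart_inv c) differentiable (at (snd c p))"
  using assms by (auto simp: differentiable_map_at_def)

lemma chart_expression_tendsto:
  assumes A: "differentiable_atlas A" and f: "differentiable_map_at A B f p"
    and c: "c \<in> charts_at A p" and d: "d \<in> charts_at B (f p)"
  shows "filterlim (snd d \<circ> f \<circ> chart_inv c) (nhds (snd d (f p))) (nhds (snd c p))"
proof -
  have "isCont (snd d \<circ> f \<circ> chart_inv c) (snd c p)"
    using differentiable_map_atD(2)[OF f c d] by (rule differentiable_imp_continuous_within)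
  moreover have "chart_inv c (snd c p) = p"
    using c by (auto simp: charts_at_def chart_inv_chart[OF A])
  ultimately show ?thesis by (simp add: continuous_at tendsto_nhds_iff)
qed

text \<open>
  The chain rule in coordinates. The outer map \<open>k\<close> has values in a vector space, so that the
  lemma serves for coordinate expressions of maps as well as for chart transitions.
\<close>

lemma chart_expression_compose:
  assumes A: "differentiable_atlas A" and B: "differentiable_atlas B"
    and f: "differentiable_map_at A B f p"
    and c: "c \<in> charts_at A p" and d: "d \<in> charts_at B (f p)"
    and k: "((\<lambda>w. k (chart_inv d w)) has_derivative k') (at (snd d (f p)))"
  shows "((\<lambda>z. k (f (chart_inv c z))) has_derivative
            (\<lambda>a. k' (frechet_derivative (snd d \<circ> f \<circ> chart_inv c) (at (snd c p)) a)))
           (at (snd c p))"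
proof -
  have p: "chart_inv c (snd c p) = p" using c by (auto simp: charts_at_def chart_inv_chart[OF A])
  have "((snd d \<circ> f \<circ> chart_inv c) has_derivative
      frechet_derivative (snd d \<circ> f \<circ> chart_inv c) (at (snd c p))) (at (snd c p))"
    using differentiable_map_atD(2)[OF f c d] by (simp add: frechet_derivative_works)
  from diff_chain_at[OF this] k p
  have "((\<lambda>z. k (chart_inv d (snd d (f (chart_inv c z))))) has_derivative
            (\<lambda>a. k' (frechet_derivative (snd d \<circ> f \<circ> chart_inv c) (at (snd c p)) a)))
           (at (snd c p))"
    by (simp add: o_def)
  then show ?thesis
  proof (rule has_derivative_cong_nhds)
    show "\<forall>\<^sub>F z in nhds (snd c p).
        k (chart_inv d (snd d (f (chart_inv c z)))) = k (f (chart_inv c z))"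
      using differentiable_map_atD(1)[OF f c d]
      by (rule eventually_mono) (use d in \<open>auto simp: charts_at_def chart_inv_chart[OF B]\<close>)
  qed
qed

lemma differentiable_map_at_compose:
  assumes A: "differentiable_atlas A" and B: "differentiable_atlas B"
    and f: "differentiable_map_at A B f p" and k: "differentiable_map_at B C k (f p)"
    and fp: "f p \<in> carrier B"
  shows "differentiable_map_at A C (k \<circ> f) p"
  unfolding differentiable_map_at_def
proof (intro ballI conjI)
  fix c e assume c: "c \<in> charts_at A p" and e: "e \<in> charts_at C ((k \<circ> f) p)"
  obtain d where d: "d \<in> charts_at B (f p)" using fp by (auto simp: carrier_def charts_at_def)
  have e': "e \<in> charts_at C (k (f p))" using e by simp
  have "\<forall>\<^sub>F z in nhds (snd c p). k (chart_inv d ((snd d \<circ> f \<circ> chart_inv c) z)) \<in> fst e"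
    using chart_expression_tendsto[OF A f c d] differentiable_map_atD(1)[OF k d e']
    unfolding filterlim_iff by blast
  with differentiable_map_atD(1)[OF f c d]
  show "\<forall>\<^sub>F z in nhds (snd c p). (k \<circ> f) (chart_inv c z) \<in> fst e"
    by eventually_elim (use d in \<open>auto simp: charts_at_def chart_inv_chart[OF B]\<close>)
  have "((\<lambda>w. snd e (k (chart_inv d w))) has_derivative
      frechet_derivative (snd e \<circ> k \<circ> chart_inv d) (at (snd d (f p)))) (at (snd d (f p)))"
    using differentiable_map_atD(2)[OF k d e'] by (simp add: frechet_derivative_works o_def)
  from chart_expression_compose[OF A B f c d, of "\<lambda>q. snd e (k q)", OF this]
  show "(snd e \<circ> (k \<circ> f) \<circ> chart_inv c) differentiable (at (snd c p))"
    by (auto simp: o_def differentiable_def)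
qed

lemma differentiable_map_at_id:
  assumes "differentiable_atlas A"
  shows "differentiable_map_at A A (\<lambda>q. q) p"
  unfolding differentiable_map_at_def
proof (intro ballI conjI)
  fix c d assume c: "c \<in> charts_at A p" and d: "d \<in> charts_at A p"
  show "\<forall>\<^sub>F z in nhds (snd c p). chart_inv c z \<in> fst d"
    using eventually_in_overlap[OF assms c d] by (rule eventually_mono) simp
  show "(snd d \<circ> (\<lambda>q. q) \<circ> chart_inv c) differentiable (at (snd c p))"
    using differentiable_atlasD(3)[OF assms c d] by (simp add: o_def)
qed

text \<open>
  Continuity of \<open>f\<close> makes the preimage of a chart domain open, whence \<open>f\<close> stays in that domain
  near \<open>p\<close>.
\<close>

lemma smooth_map_on_imp_differentiable_map_at:
  assumes A: "differentiable_atlas A" and B: "differentiable_atlas B"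
    and f: "smooth_map_on A W B f" and p: "p \<in> W"
  shows "differentiable_map_at A B f p"
  unfolding differentiable_map_at_def
proof (intro ballI conjI)
  fix c d assume c: "c \<in> charts_at A p" and d: "d \<in> charts_at B (f p)"
  have opA: "openin (atlas_topology A) X \<longleftrightarrow>
      X \<subseteq> carrier A \<and> (\<forall>c\<in>A. open (snd c ` (X \<inter> fst c)))" for X
    by (rule openin_atlas_topology) (rule differentiable_atlasD(1)[OF A])
  have opB: "openin (atlas_topology B) X \<longleftrightarrow>
      X \<subseteq> carrier B \<and> (\<forall>c\<in>B. open (snd c ` (X \<inter> fst c)))" for X
    by (rule openin_atlas_topology) (rule differentiable_atlasD(1)[OF B])
  have W: "openin (atlas_topology A) W"
    and cont: "continuous_map (subtopology (atlas_topology A) W) (atlas_topology B) f"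
    and sm: "smooth_on (snd c ` (fst c \<inter> W \<inter> f -` fst d)) (snd d \<circ> f \<circ> chart_inv c)"
    using f c d by (auto simp: smooth_map_on_def charts_at_def)
  have "openin (atlas_topology B) (fst d)"
    using d differentiable_atlasD(2)[OF B] unfolding opB
    by (auto simp: charts_at_def carrier_def Int_commute)
  then have "openin (subtopology (atlas_topology A) W)
      {q \<in> topspace (subtopology (atlas_topology A) W). f q \<in> fst d}"
    using cont by (rule openin_continuous_map_preimage[rotated])
  moreover have "{q \<in> topspace (subtopology (atlas_topology A) W). f q \<in> fst d} = W \<inter> f -` fst d"
    using openin_subset[OF W] by (auto simp: topspace_subtopology)
  ultimately have "openin (atlas_topology A) (W \<inter> f -` fst d)"
    using openin_trans_full W by fastforce
  then have op: "open (snd c ` (W \<inter> f -` fst d \<inter> fst c))"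
    using c by (auto simp: opA charts_at_def)
  have "\<forall>\<^sub>F z in nhds (snd c p). z \<in> snd c ` (W \<inter> f -` fst d \<inter> fst c)"
    using c d p by (intro eventually_nhds_in_open op) (auto simp: charts_at_def)
  then show "\<forall>\<^sub>F z in nhds (snd c p). f (chart_inv c z) \<in> fst d"
    by (rule eventually_mono) (use c in \<open>auto simp: charts_at_def chart_inv_chart[OF A]\<close>)
  show "(snd d \<circ> f \<circ> chart_inv c) differentiable (at (snd c p))"
    using sm by (rule smooth_on_imp_differentiable) (use c d p in \<open>auto simp: charts_at_def\<close>)
qed


section \<open>Tangent spaces and differentials in coordinates\<close>

lemma frechet_derivative_transition_compose:
  assumes A: "differentiable_atlas A"
    and c: "c \<in> charts_at A p" and d: "d \<in> charts_at A p" and e: "e \<in> charts_at A p"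
  shows "frechet_derivative (snd e \<circ> chart_inv c) (at (snd c p)) a =
           frechet_derivative (snd e \<circ> chart_inv d) (at (snd d p))
             (frechet_derivative (snd d \<circ> chart_inv c) (at (snd c p)) a)"
proof -
  have "((\<lambda>w. snd e (chart_inv d w)) has_derivative
      frechet_derivative (snd e \<circ> chart_inv d) (at (snd d p))) (at (snd d p))"
    using differentiable_atlasD(3)[OF A d e] by (simp add: frechet_derivative_works o_def)
  note chart_expression_compose[OF A A differentiable_map_at_id[OF A] c d this]
  from fun_cong[OF frechet_derivative_at[OF this], of a] show ?thesis by (simp add: o_def)
qed

lemma frechet_derivative_transition_self:
  assumes A: "differentiable_atlas A" and c: "c \<in> charts_at A p"
  shows "frechet_derivative (snd c \<circ> chart_inv c) (at (snd c p)) a = a"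
proof -
  have "((\<lambda>z. z) has_derivative (\<lambda>a. a)) (at (snd c p))" by simp
  then have "((snd c \<circ> chart_inv c) has_derivative (\<lambda>a. a)) (at (snd c p))"
    by (rule has_derivative_cong_nhds)
      (rule eventually_mono[OF eventually_in_overlap[OF A c c]], simp)
  from fun_cong[OF frechet_derivative_at[OF this], of a] show ?thesis by simp
qed

lemma linear_transition_derivative:
  assumes "differentiable_atlas A" and "c \<in> charts_at A p" and "d \<in> charts_at A p"
  shows "linear (frechet_derivative (snd d \<circ> chart_inv c) (at (snd c p)))"
  using differentiable_atlasD(3)[OF assms] by (rule linear_frechet_derivative)

lemma tangent_space_transition:
  assumes "v \<in> tangent_space A p" and "c \<in> charts_at A p" and "d \<in> charts_at A p"
  shows "v d = frechet_derivative (snd d \<circ> chart_inv c) (at (snd c p)) (v c)"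
  using assms unfolding tangent_space_def by blast

lemma tangent_space_outside:
  "v \<in> tangent_space A p \<Longrightarrow> c \<notin> charts_at A p \<Longrightarrow> v c = 0"
  unfolding tangent_space_def by blast

lemma tangent_spaceI:
  assumes "\<And>c. c \<notin> charts_at A p \<Longrightarrow> v c = 0"
    and "\<And>c d. c \<in> charts_at A p \<Longrightarrow> d \<in> charts_at A p \<Longrightarrow>
           v d = frechet_derivative (snd d \<circ> chart_inv c) (at (snd c p)) (v c)"
  shows "v \<in> tangent_space A p"
  using assms unfolding tangent_space_def by blast

lemma tangent_space_eqI:
  assumes v: "v \<in> tangent_space A p" and w: "w \<in> tangent_space A p"
    and c: "c \<in> charts_at A p" and eq: "v c = w c"
  shows "v = w"
proof
  fix d show "v d = w d"
  proof (cases "d \<in> charts_at A p")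
    case True
    then show ?thesis
      using tangent_space_transition[OF v c] tangent_space_transition[OF w c] eq by simp
  qed (use v w in \<open>simp add: tangent_space_outside\<close>)
qed

lemma inj_on_coords: "c \<in> charts_at A p \<Longrightarrow> inj_on (\<lambda>v. v c) (tangent_space A p)"
  by (rule inj_onI) (rule tangent_space_eqI)

lemma subspace_tangent_space:
  assumes "differentiable_atlas A"
  shows "subspace (tangent_space A p)"
  unfolding subspace_def
  by (intro conjI ballI allI; rule tangent_spaceI)
    (simp_all add: tangent_space_outside tangent_space_transition[symmetric]
      linear_0[OF linear_transition_derivative[OF assms]]
      linear_add[OF linear_transition_derivative[OF assms]]
      linear_scale[OF linear_transition_derivative[OF assms]])

lemma vector_of_coords:
  assumes A: "differentiable_atlas A" and c: "c \<in> charts_at A p"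
  shows "vector_of_coords A c p a \<in> tangent_space A p" and "vector_of_coords A c p a c = a"
proof -
  define v where "v d = (if d \<in> charts_at A p
    then frechet_derivative (snd d \<circ> chart_inv c) (at (snd c p)) a else 0)" for d
  have "v \<in> tangent_space A p"
    by (rule tangent_spaceI)
      (simp_all add: v_def frechet_derivative_transition_compose[OF A c, symmetric])
  moreover have "v c = a" using frechet_derivative_transition_self[OF A c] c by (simp add: v_def)
  ultimately have "\<exists>!v. v \<in> tangent_space A p \<and> v c = a"
    using tangent_space_eqI[OF _ _ c] by (intro ex1I[of _ v]) auto
  from theI'[OF this] show "vector_of_coords A c p a \<in> tangent_space A p"
    and "vector_of_coords A c p a c = a"
    by (auto simp: vector_of_coords_def)
qed

lemma vector_of_coords_coords:
  assumes A: "differentiable_atlas A" and c: "c \<in> charts_at A p" and v: "v \<in> tangent_space A p"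
  shows "vector_of_coords A c p (v c) = v"
  using vector_of_coords[OF A c] v by (intro tangent_space_eqI[OF _ _ c]) auto

lemma linear_vector_of_coords:
  assumes A: "differentiable_atlas A" and c: "c \<in> charts_at A p"
  shows "linear (vector_of_coords A c p)"
proof (rule linearI)
  have S: "subspace (tangent_space A p)" by (rule subspace_tangent_space[OF A])
  note coords = vector_of_coords[OF A c]
  show "vector_of_coords A c p (a + b) = vector_of_coords A c p a + vector_of_coords A c p b" for a b
    by (rule tangent_space_eqI[OF coords(1) subspace_add[OF S coords(1) coords(1)] c])
      (simp add: coords(2))
  show "vector_of_coords A c p (r *\<^sub>R a) = r *\<^sub>R vector_of_coords A c p a" for r a
    by (rule tangent_space_eqI[OF coords(1) subspace_scale[OF S coords(1)] c])
      (simp add: coords(2))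
qed

lemma bij_betw_vector_of_coords:
  assumes A: "differentiable_atlas A" and c: "c \<in> charts_at A p"
  shows "bij_betw (vector_of_coords A c p) UNIV (tangent_space A p)"
  by (rule bij_betw_byWitness[where f' = "\<lambda>v. v c"])
    (auto simp: vector_of_coords[OF A c] vector_of_coords_coords[OF A c])

lemma some_chart_in:
  assumes "p \<in> carrier A"
  shows "some_chart A p \<in> charts_at A p"
  unfolding some_chart_def
  by (rule someI_ex) (use assms in \<open>auto simp: carrier_def charts_at_def\<close>)

lemma differential_in_tangent_space:
  assumes A: "differentiable_atlas A" and B: "differentiable_atlas B"
    and f: "differentiable_map_at A B f p" and p: "p \<in> carrier A"
  shows "differential A B f p v \<in> tangent_space B (f p)"
proof -
  define c where "c = some_chart A p"
  have c: "c \<in> charts_at A p" using some_chart_in[OF p] by (simp add: c_def)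
  have chain: "frechet_derivative (snd e \<circ> f \<circ> chart_inv c) (at (snd c p)) a =
      frechet_derivative (snd e \<circ> chart_inv d) (at (snd d (f p)))
        (frechet_derivative (snd d \<circ> f \<circ> chart_inv c) (at (snd c p)) a)"
    if d: "d \<in> charts_at B (f p)" and e: "e \<in> charts_at B (f p)" for d e a
  proof -
    have "((\<lambda>w. snd e (chart_inv d w)) has_derivative
        frechet_derivative (snd e \<circ> chart_inv d) (at (snd d (f p)))) (at (snd d (f p)))"
      using differentiable_atlasD(3)[OF B d e] by (simp add: frechet_derivative_works o_def)
    note chart_expression_compose[OF A B f c d this]
    from fun_cong[OF frechet_derivative_at[OF this], of a] show ?thesis by (simp add: o_def)
  qed
  show ?thesis
    by (rule tangent_spaceI) (simp_all add: differential_def Let_def c_def[symmetric] chain[symmetric])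
qed

lemma differential_linear:
  assumes f: "differentiable_map_at A B f p" and p: "p \<in> carrier A"
  shows "differential A B f p (v + w) = differential A B f p v + differential A B f p w"
    and "differential A B f p (r *\<^sub>R v) = r *\<^sub>R differential A B f p v"
proof -
  have "linear (frechet_derivative (snd d \<circ> f \<circ> chart_inv (some_chart A p))
      (at (snd (some_chart A p) p)))" if "d \<in> charts_at B (f p)" for d
    using differentiable_map_atD(2)[OF f some_chart_in[OF p] that]
    by (rule linear_frechet_derivative)
  then show "differential A B f p (v + w) = differential A B f p v + differential A B f p w"
    and "differential A B f p (r *\<^sub>R v) = r *\<^sub>R differential A B f p v"
    by (auto simp: differential_def Let_def fun_eq_iff linear_add linear_scale)
qed


section \<open>The tangent bundle\<close>

lemma fst_tangent_chart [simp]: "fst (tangent_chart A c) = Sigma (fst c) (tangent_space A)"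
  by (simp add: tangent_chart_def)

lemma snd_tangent_chart [simp]: "snd (tangent_chart A c) P = (snd c (fst P), snd P c)"
  by (simp add: tangent_chart_def split_beta)

lemma carrier_tangent_atlas: "carrier (tangent_atlas A) = tangent_bundle A"
  by (auto simp: carrier_def tangent_atlas_def tangent_bundle_def)

lemma charts_at_tangent_atlas:
  "P \<in> tangent_bundle A \<Longrightarrow>
     charts_at (tangent_atlas A) P = tangent_chart A ` charts_at A (fst P)"
  by (auto simp: charts_at_def tangent_atlas_def tangent_bundle_def)

lemma inj_on_tangent_chart:
  assumes A: "differentiable_atlas A" and c: "c \<in> A"
  shows "inj_on (snd (tangent_chart A c)) (fst (tangent_chart A c))"
proof (rule inj_onI)
  fix P Q
  assume P: "P \<in> fst (tangent_chart A c)" and Q: "Q \<in> fst (tangent_chart A c)"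
    and eq: "snd (tangent_chart A c) P = snd (tangent_chart A c) Q"
  have "fst P = fst Q"
    using P Q eq inj_onD[OF differentiable_atlasD(1)[OF A c], of "fst P" "fst Q"] by auto
  moreover from this have "snd P = snd Q"
    using P Q eq c by (intro tangent_space_eqI[of _ A "fst P" _ c]) (auto simp: charts_at_def)
  ultimately show "P = Q" by (rule prod_eqI)
qed

lemma chart_inv_tangent_chart:
  assumes A: "differentiable_atlas A" and c: "c \<in> charts_at A q"
  shows "chart_inv (tangent_chart A c) (snd c q, a) = (q, vector_of_coords A c q a)"
proof -
  have c': "c \<in> A" using c by (simp add: charts_at_def)
  have "snd (tangent_chart A c) (q, vector_of_coords A c q a) = (snd c q, a)"
    by (simp add: vector_of_coords[OF A c])
  moreover have "(q, vector_of_coords A c q a) \<in> fst (tangent_chart A c)"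
    using c by (simp add: vector_of_coords[OF A c] charts_at_def)
  ultimately show ?thesis
    unfolding chart_inv_def using inv_into_f_f[OF inj_on_tangent_chart[OF A c']] by metis
qed

lemma tangent_chart_image:
  fixes A :: "('a, 'e::euclidean_space) chart set"
  assumes A: "differentiable_atlas A" and c: "c \<in> A" and W: "W \<subseteq> fst c"
  shows "snd (tangent_chart A c) ` Sigma W (tangent_space A) = (snd c ` W) \<times> UNIV"
proof (intro set_eqI iffI)
  fix x assume "x \<in> (snd c ` W) \<times> (UNIV :: 'e set)"
  then obtain q where q: "q \<in> W" "x = (snd c q, snd x)" by auto
  have cq: "c \<in> charts_at A q" using q c W by (auto simp: charts_at_def)
  have "x = snd (tangent_chart A c) (q, vector_of_coords A c q (snd x))"
    using q(2) by (simp add: vector_of_coords[OF A cq])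
  moreover have "(q, vector_of_coords A c q (snd x)) \<in> Sigma W (tangent_space A)"
    using q(1) by (simp add: vector_of_coords[OF A cq])
  ultimately show "x \<in> snd (tangent_chart A c) ` Sigma W (tangent_space A)" by (rule image_eqI)
qed auto

text \<open>
  Expanding the direction in the basis reduces the joint dependence on base point and direction
  to the partial derivatives of \<open>\<phi>\<close>, which are differentiable.
\<close>

lemma differentiable_derivative_map:
  fixes \<phi> :: "'e::euclidean_space \<Rightarrow> 'e"
  assumes S: "open S" "z \<in> S" and \<phi>: "smooth_on S \<phi>"
  shows "(\<lambda>x. (\<phi> (fst x), frechet_derivative \<phi> (at (fst x)) (snd x))) differentiable (at (z, a))"
proof -
  have lin: "linear (frechet_derivative \<phi> (at x))" if "x \<in> S" for x
    using smooth_on_imp_differentiable[OF \<phi> that] by (rule linear_frechet_derivative)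
  have along_fst: "(\<lambda>x::'e \<times> 'e. f (fst x)) differentiable (at (z, a))"
    if "f differentiable (at z)" for f :: "'e \<Rightarrow> 'e"
  proof -
    obtain D where "(f has_derivative D) (at (fst (z, a)))"
      using \<open>f differentiable (at z)\<close> by (auto simp: differentiable_def)
    from has_derivative_compose[OF has_derivative_fst[OF has_derivative_ident] this]
    show ?thesis by (auto simp: differentiable_def)
  qed
  have coord: "(\<lambda>x::'e \<times> 'e. snd x \<bullet> b) differentiable (at (z, a))" for b
    unfolding differentiable_def
    by (rule exI, rule has_derivative_inner_left, rule has_derivative_snd, rule has_derivative_ident)
  have "(\<lambda>x. \<Sum>b\<in>Basis. (snd x \<bullet> b) *\<^sub>R frechet_derivative \<phi> (at (fst x)) b) differentiable (at (z, a))"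
    by (intro differentiable_sum ballI finite_Basis differentiable_scaleR along_fst coord
        smooth_on_imp_derivative_differentiable[OF \<phi> S(2)])
  moreover have "(\<lambda>x::'e \<times> 'e. \<phi> (fst x)) differentiable (at (z, a))"
    by (rule along_fst[OF smooth_on_imp_differentiable[OF \<phi> S(2)]])
  ultimately have "(\<lambda>x. (\<phi> (fst x),
      \<Sum>b\<in>Basis. (snd x \<bullet> b) *\<^sub>R frechet_derivative \<phi> (at (fst x)) b)) differentiable (at (z, a))"
    unfolding differentiable_def by (auto intro: has_derivative_Pair)
  then obtain D where D: "((\<lambda>x. (\<phi> (fst x),
      \<Sum>b\<in>Basis. (snd x \<bullet> b) *\<^sub>R frechet_derivative \<phi> (at (fst x)) b)) has_derivative D) (at (z, a))"
    by (auto simp: differentiable_def)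
  have "(\<Sum>b\<in>Basis. (w \<bullet> b) *\<^sub>R frechet_derivative \<phi> (at x) b) = frechet_derivative \<phi> (at x) w"
    if "x \<in> S" for x w
  proof -
    have "frechet_derivative \<phi> (at x) (\<Sum>b\<in>Basis. (w \<bullet> b) *\<^sub>R b) =
        (\<Sum>b\<in>Basis. (w \<bullet> b) *\<^sub>R frechet_derivative \<phi> (at x) b)"
      by (simp add: linear_sum[OF lin[OF that]] linear_scale[OF lin[OF that]])
    then show ?thesis by (simp add: euclidean_representation)
  qed
  moreover have "\<forall>\<^sub>F x in nhds (z, a). x \<in> S \<times> (UNIV :: 'e set)"
    using S by (intro eventually_nhds_in_open open_Times) auto
  ultimately have "\<forall>\<^sub>F x in nhds (z, a). (\<phi> (fst x),
      \<Sum>b\<in>Basis. (snd x \<bullet> b) *\<^sub>R frechet_derivative \<phi> (at (fst x)) b) =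
      (\<phi> (fst x), frechet_derivative \<phi> (at (fst x)) (snd x))"
    by (auto elim!: eventually_mono)
  from has_derivative_cong_nhds[OF D this] show ?thesis by (auto simp: differentiable_def)
qed

text \<open>
  The transitions of \<open>TM\<close> are \<open>(z, a) \<mapsto> (\<phi> z, d\<phi>\<^sub>z a)\<close> for transitions \<open>\<phi>\<close> of \<open>M\<close>. Their
  differentiability therefore involves the second derivatives of \<open>\<phi>\<close>.
\<close>

lemma differentiable_atlas_tangent_atlas:
  assumes "smooth_atlas A"
  shows "differentiable_atlas (tangent_atlas A)"
proof -
  have A: "differentiable_atlas A" using assms by (rule smooth_atlas_imp_differentiable_atlas)
  have overlap: "fst (tangent_chart A c) \<inter> fst (tangent_chart A d) =
      Sigma (fst c \<inter> fst d) (tangent_space A)" for c d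
    by auto
  have "(snd (tangent_chart A d) \<circ> chart_inv (tangent_chart A c))
      differentiable (at (snd (tangent_chart A c) P))"
    if c: "c \<in> A" and d: "d \<in> A" and P: "P \<in> Sigma (fst c \<inter> fst d) (tangent_space A)" for c d P
  proof -
    define S where "S = snd c ` (fst c \<inter> fst d)"
    define \<phi> where "\<phi> = snd d \<circ> chart_inv c"
    have S: "open S" "snd c (fst P) \<in> S" and \<phi>: "smooth_on S \<phi>"
      using assms c d P by (auto simp: smooth_atlas_def S_def \<phi>_def)
    obtain D where D: "((\<lambda>x. (\<phi> (fst x), frechet_derivative \<phi> (at (fst x)) (snd x)))
        has_derivative D) (at (snd c (fst P), snd P c))"
      using differentiable_derivative_map[OF S \<phi>] by (auto simp: differentiable_def)
    have "(\<phi> z, frechet_derivative \<phi> (at z) a) =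
        (snd (tangent_chart A d) \<circ> chart_inv (tangent_chart A c)) (z, a)" if z: "z \<in> S" for z a
    proof -
      obtain q where q: "q \<in> fst c \<inter> fst d" "z = snd c q" using z by (auto simp: S_def)
      have cq: "c \<in> charts_at A q" and dq: "d \<in> charts_at A q"
        using q c d by (auto simp: charts_at_def)
      show ?thesis
        using q tangent_space_transition[OF vector_of_coords(1)[OF A cq] cq dq, of a]
        by (simp add: chart_inv_tangent_chart[OF A cq] \<phi>_def chart_inv_chart[OF A c]
            vector_of_coords[OF A cq])
    qed
    moreover have "\<forall>\<^sub>F x in nhds (snd c (fst P), snd P c). x \<in> S \<times> UNIV"
      using S by (intro eventually_nhds_in_open open_Times) auto
    ultimately have "\<forall>\<^sub>F x in nhds (snd c (fst P), snd P c).
        (\<phi> (fst x), frechet_derivative \<phi> (at (fst x)) (snd x)) =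
        (snd (tangent_chart A d) \<circ> chart_inv (tangent_chart A c)) x"
      by (auto elim!: eventually_mono)
    from has_derivative_cong_nhds[OF D this] show ?thesis
      unfolding differentiable_def snd_tangent_chart by blast
  qed
  moreover have "open (snd (tangent_chart A c) `
      (fst (tangent_chart A c) \<inter> fst (tangent_chart A d)))" if "c \<in> A" "d \<in> A" for c d
    unfolding overlap using that differentiable_atlasD(2)[OF A that]
    by (simp only: tangent_chart_image[OF A that(1) Int_lower1] open_Times open_UNIV)
  ultimately show ?thesis
    unfolding differentiable_atlas_def tangent_atlas_def
    using inj_on_tangent_chart[OF A] by (simp only: ball_simps overlap) blast
qed

lemma differentiable_fiber_scale:
  assumes A: "smooth_atlas A" and P: "P \<in> tangent_bundle A"
  shows "differentiable_map_at (tangent_atlas A) (tangent_atlas A) (fiber_scale r) P"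
  unfolding differentiable_map_at_def
proof (intro ballI conjI)
  have sub: "subspace (tangent_space A q)" for q
    by (rule subspace_tangent_space[OF smooth_atlas_imp_differentiable_atlas[OF A]])
  note TA = differentiable_atlas_tangent_atlas[OF A]
  have rP: "fiber_scale r P \<in> tangent_bundle A"
    using P subspace_scale[OF sub] by (auto simp: fiber_scale_def tangent_bundle_def)
  fix C E assume C: "C \<in> charts_at (tangent_atlas A) P"
    and "E \<in> charts_at (tangent_atlas A) (fiber_scale r P)"
  then obtain e where e: "e \<in> charts_at A (fst P)" "E = tangent_chart A e"
    unfolding charts_at_tangent_atlas[OF rP] by (auto simp: fiber_scale_def)
  then have E: "E \<in> charts_at (tangent_atlas A) P" by (auto simp: charts_at_tangent_atlas[OF P])
  note ev = eventually_in_overlap[OF TA C E]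
  show "\<forall>\<^sub>F z in nhds (snd C P). fiber_scale r (chart_inv C z) \<in> fst E"
    using ev by (rule eventually_mono)
      (use subspace_scale[OF sub] e in \<open>auto simp: fiber_scale_def\<close>)
  obtain D where "((\<lambda>z. snd E (chart_inv C z)) has_derivative D) (at (snd C P))"
    using differentiable_atlasD(3)[OF TA C E] by (auto simp: differentiable_def o_def)
  then have "((\<lambda>z. (fst (snd E (chart_inv C z)), r *\<^sub>R snd (snd E (chart_inv C z))))
      has_derivative (\<lambda>a. (fst (D a), r *\<^sub>R snd (D a)))) (at (snd C P))"
    by (intro has_derivative_Pair has_derivative_scaleR_right has_derivative_fst has_derivative_snd)
  moreover have "(\<lambda>z. (fst (snd E (chart_inv C z)), r *\<^sub>R snd (snd E (chart_inv C z)))) =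
      snd E \<circ> fiber_scale r \<circ> chart_inv C"
    by (auto simp: e(2) fiber_scale_def)
  ultimately show "(snd E \<circ> fiber_scale r \<circ> chart_inv C) differentiable (at (snd C P))"
    by (auto simp: differentiable_def)
qed

lemma differentiable_projection:
  assumes A: "smooth_atlas A" and P: "P \<in> tangent_bundle A"
  shows "differentiable_map_at (tangent_atlas A) A fst P"
  unfolding differentiable_map_at_def
proof (intro ballI conjI)
  note TA = differentiable_atlas_tangent_atlas[OF A]
  fix C e assume C: "C \<in> charts_at (tangent_atlas A) P" and e: "e \<in> charts_at A (fst P)"
  then have E: "tangent_chart A e \<in> charts_at (tangent_atlas A) P"
    by (auto simp: charts_at_tangent_atlas[OF P])
  show "\<forall>\<^sub>F z in nhds (snd C P). fst (chart_inv C z) \<in> fst e"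
    using eventually_in_overlap[OF TA C E] by (rule eventually_mono) auto
  obtain D where "((snd (tangent_chart A e) \<circ> chart_inv C) has_derivative D) (at (snd C P))"
    using differentiable_atlasD(3)[OF TA C E] by (auto simp: differentiable_def)
  from has_derivative_fst[OF this]
  have "((snd e \<circ> fst \<circ> chart_inv C) has_derivative (\<lambda>a. fst (D a))) (at (snd C P))"
    by (simp add: o_def)
  then show "(snd e \<circ> fst \<circ> chart_inv C) differentiable (at (snd C P))"
    by (auto simp: differentiable_def)
qed

text \<open>
  The chart underlying \<open>differential\<close> at \<open>P\<close> comes from a chart \<open>c\<close> of \<open>M\<close>; using that same \<open>c\<close>
  on \<open>M\<close> makes the coordinate expression of the projection exactly \<open>fst\<close>.
\<close>

lemma differential_projection_coords:
  assumes A: "smooth_atlas A" and P: "P \<in> tangent_bundle A"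
    and c: "c \<in> charts_at A (fst P)" and C: "some_chart (tangent_atlas A) P = tangent_chart A c"
  shows "differential (tangent_atlas A) A fst P \<xi> c = fst (\<xi> (tangent_chart A c))"
proof -
  note TA = differentiable_atlas_tangent_atlas[OF A]
  have Cat: "tangent_chart A c \<in> charts_at (tangent_atlas A) P"
    using c by (auto simp: charts_at_tangent_atlas[OF P])
  have "(fst has_derivative fst) (at (snd (tangent_chart A c) P))"
    by (rule has_derivative_fst[OF has_derivative_ident])
  then have "((snd c \<circ> fst \<circ> chart_inv (tangent_chart A c)) has_derivative fst)
      (at (snd (tangent_chart A c) P))"
    by (rule has_derivative_cong_nhds,
        intro eventually_mono[OF eventually_in_overlap[OF TA Cat Cat]]) (auto simp: prod_eq_iff)
  from frechet_derivative_at[OF this, symmetric] show ?thesis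
    using c by (simp add: differential_def Let_def C)
qed


section \<open>Tangent spaces as manifolds\<close>

lemma charts_at_fiber_atlas:
  "u \<in> tangent_space A y \<Longrightarrow>
     charts_at (fiber_atlas A y) u = (\<lambda>c. (tangent_space A y, \<lambda>v. v c)) ` charts_at A y"
  by (auto simp: charts_at_def fiber_atlas_def)

lemma carrier_fiber_atlas:
  "y \<in> carrier A \<Longrightarrow> carrier (fiber_atlas A y) = tangent_space A y"
  by (auto simp: carrier_def charts_at_def fiber_atlas_def)

lemma chart_inv_fiber_chart:
  assumes A: "differentiable_atlas A" and c: "c \<in> charts_at A y"
  shows "chart_inv (tangent_space A y, \<lambda>v. v c) = vector_of_coords A c y"
proof
  fix a
  note inj = inj_on_coords[OF c]
  show "chart_inv (tangent_space A y, \<lambda>v. v c) a = vector_of_coords A c y a"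
    using inv_into_f_f[OF inj vector_of_coords(1)[OF A c, of a]]
    by (simp add: chart_inv_def vector_of_coords(2)[OF A c])
qed

text \<open>Transitions between linear coordinates are the derivatives of the transitions of \<open>M\<close>.\<close>

lemma fiber_transition:
  assumes A: "differentiable_atlas A" and c: "c \<in> charts_at A y" and d: "d \<in> charts_at A y"
  shows "((\<lambda>a. vector_of_coords A c y a d) has_derivative
            frechet_derivative (snd d \<circ> chart_inv c) (at (snd c y))) (at z)"
proof -
  have "(\<lambda>a. vector_of_coords A c y a d) =
      frechet_derivative (snd d \<circ> chart_inv c) (at (snd c y))"
    using tangent_space_transition[OF vector_of_coords(1)[OF A c] c d]
    by (simp add: vector_of_coords(2)[OF A c] fun_eq_iff)
  then show ?thesis
    using linear_imp_has_derivative[OF linear_transition_derivative[OF A c d]] by simp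
qed

lemma differentiable_atlas_fiber_atlas:
  assumes A: "differentiable_atlas A"
  shows "differentiable_atlas (fiber_atlas A y)"
  unfolding differentiable_atlas_def fiber_atlas_def ball_simps
proof (intro conjI ballI)
  fix c assume c: "c \<in> charts_at A y"
  show "inj_on (snd (tangent_space A y, \<lambda>v. v c)) (fst (tangent_space A y, \<lambda>v. v c))"
    using inj_on_coords[OF c] by simp
  fix d assume d: "d \<in> charts_at A y"
  have "(\<lambda>v. v c) ` tangent_space A y = UNIV"
  proof (rule UNIV_eq_I[symmetric])
    show "a \<in> (\<lambda>v. v c) ` tangent_space A y" for a
      by (rule image_eqI[of _ _ "vector_of_coords A c y a"]) (simp_all add: vector_of_coords[OF A c])
  qed
  then show "open (snd (tangent_space A y, \<lambda>v. v c) `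
      (fst (tangent_space A y, \<lambda>v. v c) \<inter> fst (tangent_space A y, \<lambda>v. v d)))"
    by simp
  fix u
  show "(snd (tangent_space A y, \<lambda>v. v d) \<circ> chart_inv (tangent_space A y, \<lambda>v. v c))
      differentiable (at (snd (tangent_space A y, \<lambda>v. v c) u))"
    using fiber_transition[OF A c d] by (auto simp: chart_inv_fiber_chart[OF A c] differentiable_def o_def)
qed

lemma to_fiber_tangent_coords:
  "c \<in> charts_at A y \<Longrightarrow> to_fiber_tangent A y w (tangent_space A y, \<lambda>v. v c) = w c"
  by (simp add: to_fiber_tangent_def fiber_atlas_def)

lemma to_fiber_tangent_in_tangent_space:
  assumes A: "differentiable_atlas A" and w: "w \<in> tangent_space A y" and u: "u \<in> tangent_space A y"
  shows "to_fiber_tangent A y w \<in> tangent_space (fiber_atlas A y) u"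
proof (rule tangent_spaceI)
  fix C assume "C \<notin> charts_at (fiber_atlas A y) u"
  then show "to_fiber_tangent A y w C = 0"
    using u by (auto simp: to_fiber_tangent_def charts_at_def fiber_atlas_def)
next
  fix C D assume "C \<in> charts_at (fiber_atlas A y) u" "D \<in> charts_at (fiber_atlas A y) u"
  then obtain c d where c: "c \<in> charts_at A y" "C = (tangent_space A y, \<lambda>v. v c)"
    and d: "d \<in> charts_at A y" "D = (tangent_space A y, \<lambda>v. v d)"
    using u by (auto simp: charts_at_fiber_atlas)
  show "to_fiber_tangent A y w D =
      frechet_derivative (snd D \<circ> chart_inv C) (at (snd C u)) (to_fiber_tangent A y w C)"
    using tangent_space_transition[OF w c(1) d(1)]
      frechet_derivative_at[OF fiber_transition[OF A c(1) d(1), of "u c"]]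
    by (simp add: c d to_fiber_tangent_coords chart_inv_fiber_chart[OF A c(1)] o_def)
qed

text \<open>
  Undoing the identification of \<open>T\<^sub>yM\<close> with its own tangent spaces by reading off coordinates in
  a chart \<open>c\<close>, which may be chosen freely.
\<close>

lemma of_fiber_tangent:
  assumes A: "differentiable_atlas A" and c: "c \<in> charts_at A y" and u: "u \<in> tangent_space A y"
    and \<eta>: "\<eta> \<in> tangent_space (fiber_atlas A y) u"
  shows "of_fiber_tangent A y \<eta> = vector_of_coords A c y (\<eta> (tangent_space A y, \<lambda>v. v c))"
proof -
  define w where "w = vector_of_coords A c y (\<eta> (tangent_space A y, \<lambda>v. v c))"
  have w: "w \<in> tangent_space A y" unfolding w_def by (rule vector_of_coords(1)[OF A c])
  have "inj_on (to_fiber_tangent A y) (tangent_space A y)"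
  proof (rule inj_onI)
    fix v v'
    assume v: "v \<in> tangent_space A y" "v' \<in> tangent_space A y"
      and eq: "to_fiber_tangent A y v = to_fiber_tangent A y v'"
    show "v = v'"
      using fun_cong[OF eq, of "(tangent_space A y, \<lambda>v. v c)"]
      by (intro tangent_space_eqI[OF v c]) (simp add: to_fiber_tangent_coords[OF c])
  qed
  moreover have "to_fiber_tangent A y w = \<eta>"
    by (rule tangent_space_eqI[OF to_fiber_tangent_in_tangent_space[OF A w u] \<eta>,
          of "(tangent_space A y, \<lambda>v. v c)"])
      (use u c in \<open>auto simp: charts_at_fiber_atlas to_fiber_tangent_coords w_def vector_of_coords[OF A c]\<close>)
  ultimately show ?thesis
    using the_inv_into_f_f[of "to_fiber_tangent A y" "tangent_space A y" w] w
    by (simp add: of_fiber_tangent_def w_def[symmetric])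
qed


section \<open>The Sasaki metric\<close>

lemma fiber_inclusion_derivative:
  assumes A: "differentiable_atlas A" and c: "c \<in> charts_at A x" and d: "d \<in> charts_at A x"
  shows "((snd (tangent_chart A d) \<circ> (\<lambda>v. (x, v)) \<circ> chart_inv (tangent_space A x, \<lambda>v. v c))
           has_derivative (\<lambda>a. (0, frechet_derivative (snd d \<circ> chart_inv c) (at (snd c x)) a))) (at z)"
  using has_derivative_Pair[OF has_derivative_const fiber_transition[OF A c d]]
  by (simp add: o_def chart_inv_fiber_chart[OF A c])

lemma differentiable_fiber_inclusion:
  assumes A: "smooth_atlas A" and P: "(x, v) \<in> tangent_bundle A"
  shows "differentiable_map_at (fiber_atlas A x) (tangent_atlas A) (\<lambda>v. (x, v)) v"
  unfolding differentiable_map_at_def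
proof (intro ballI conjI)
  have A': "differentiable_atlas A" using A by (rule smooth_atlas_imp_differentiable_atlas)
  fix C D assume "C \<in> charts_at (fiber_atlas A x) v" "D \<in> charts_at (tangent_atlas A) (x, v)"
  then obtain c d where c: "c \<in> charts_at A x" "C = (tangent_space A x, \<lambda>v. v c)"
    and d: "d \<in> charts_at A x" "D = tangent_chart A d"
    using P by (auto simp: charts_at_fiber_atlas charts_at_tangent_atlas[OF P] tangent_bundle_def)
  show "(snd D \<circ> (\<lambda>v. (x, v)) \<circ> chart_inv C) differentiable (at (snd C v))"
    unfolding c d differentiable_def using fiber_inclusion_derivative[OF A' c(1) d(1)] by blast
  show "\<forall>\<^sub>F z in nhds (snd C v). (x, chart_inv C z) \<in> fst D"
    using d(1) by (simp add: c d chart_inv_fiber_chart[OF A' c(1)] vector_of_coords[OF A' c(1)] charts_at_def)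
qed

lemma vertical_lift_in_tangent_space:
  assumes A: "smooth_atlas A" and P: "P \<in> tangent_bundle A" and w: "w \<in> tangent_space A (fst P)"
  shows "vertical_lift A P w \<in> tangent_space (tangent_atlas A) P"
proof -
  have A': "differentiable_atlas A" using A by (rule smooth_atlas_imp_differentiable_atlas)
  have "snd P \<in> carrier (fiber_atlas A (fst P))"
    using P by (auto simp: carrier_fiber_atlas tangent_bundle_def)
  from differential_in_tangent_space[OF differentiable_atlas_fiber_atlas[OF A']
      differentiable_atlas_tangent_atlas[OF A] differentiable_fiber_inclusion[OF A] this]
  show ?thesis using P by (simp add: vertical_lift_def)
qed

lemma vertical_lift_coords:
  assumes A: "smooth_atlas A" and P: "P \<in> tangent_bundle A" and w: "w \<in> tangent_space A (fst P)"
    and d: "d \<in> charts_at A (fst P)"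
  shows "vertical_lift A P w (tangent_chart A d) = (0, w d)"
proof -
  have A': "differentiable_atlas A" using A by (rule smooth_atlas_imp_differentiable_atlas)
  have v: "snd P \<in> tangent_space A (fst P)" and x: "fst P \<in> carrier A"
    using P by (auto simp: tangent_bundle_def)
  have "some_chart (fiber_atlas A (fst P)) (snd P) \<in> charts_at (fiber_atlas A (fst P)) (snd P)"
    using v x by (intro some_chart_in) (simp add: carrier_fiber_atlas)
  then obtain c where c: "c \<in> charts_at A (fst P)"
    and C: "some_chart (fiber_atlas A (fst P)) (snd P) = (tangent_space A (fst P), \<lambda>v. v c)"
    by (auto simp: charts_at_fiber_atlas[OF v])
  have D: "tangent_chart A d \<in> charts_at (tangent_atlas A) (fst P, snd P)"
    using d by (auto simp: charts_at_tangent_atlas[OF P])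
  show ?thesis
    using frechet_derivative_at[OF fiber_inclusion_derivative[OF A' c d, of "snd P c"], symmetric]
      D tangent_space_transition[OF w c d]
    by (simp add: vertical_lift_def differential_def Let_def C to_fiber_tangent_coords[OF c])
qed

text \<open>
  In the coordinates of a tangent chart, \<open>d\<pi>\<close> is the first projection and the vertical lift is
  the inclusion of the second factor.
\<close>

lemma vertical_if_projection_zero:
  assumes A: "smooth_atlas A" and P: "P \<in> tangent_bundle A"
    and \<xi>: "\<xi> \<in> tangent_space (tangent_atlas A) P"
    and zero: "differential (tangent_atlas A) A fst P \<xi> = 0"
  obtains w where "w \<in> tangent_space A (fst P)" and "\<xi> = vertical_lift A P w"
proof -
  have A': "differentiable_atlas A" using A by (rule smooth_atlas_imp_differentiable_atlas)
  have "some_chart (tangent_atlas A) P \<in> charts_at (tangent_atlas A) P"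
    using P by (intro some_chart_in) (simp add: carrier_tangent_atlas)
  then obtain c where c: "c \<in> charts_at A (fst P)"
    and C: "some_chart (tangent_atlas A) P = tangent_chart A c"
    by (auto simp: charts_at_tangent_atlas[OF P])
  define w where "w = vector_of_coords A c (fst P) (snd (\<xi> (tangent_chart A c)))"
  have w: "w \<in> tangent_space A (fst P)" unfolding w_def by (rule vector_of_coords(1)[OF A' c])
  have Cat: "tangent_chart A c \<in> charts_at (tangent_atlas A) P"
    using c by (auto simp: charts_at_tangent_atlas[OF P])
  have "\<xi> (tangent_chart A c) = (0, w c)"
    using differential_projection_coords[OF A P c C, of \<xi>] zero
    by (simp add: w_def vector_of_coords(2)[OF A' c] prod_eq_iff)
  then have "\<xi> = vertical_lift A P w"
    by (intro tangent_space_eqI[OF \<xi> vertical_lift_in_tangent_space[OF A P w] Cat])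
      (simp add: vertical_lift_coords[OF A P w c])
  then show ?thesis using w that by blast
qed

text \<open>
  Definiteness holds because a vector in the kernel of \<open>d\<pi>\<close> is the vertical lift of some \<open>w\<close>, and
  the connector recovers \<open>w\<close>.
\<close>

lemma inner_product_on_sasaki_metric:
  assumes g: "riemannian_manifold A g" and K: "connector A K" and P: "P \<in> tangent_bundle A"
  shows "inner_product_on (tangent_space (tangent_atlas A) P) (sasaki_metric A g K P)"
proof -
  have A: "smooth_atlas A" using g by (auto simp: riemannian_manifold_def smooth_manifold_def)
  have A': "differentiable_atlas A" using A by (rule smooth_atlas_imp_differentiable_atlas)
  note TA = differentiable_atlas_tangent_atlas[OF A]
  have x: "fst P \<in> carrier A" using P by (auto simp: tangent_bundle_def)
  have ip: "inner_product_on (tangent_space A (fst P)) (g (fst P))"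
    using g x by (auto simp: riemannian_manifold_def)
  let ?T = "tangent_space (tangent_atlas A) P" and ?S = "tangent_space A (fst P)"
  let ?p = "differential (tangent_atlas A) A fst P" and ?k = "\<lambda>\<xi>. snd (K (P, \<xi>))"
  have Pc: "P \<in> carrier (tangent_atlas A)" using P by (simp add: carrier_tangent_atlas)
  note \<pi> = differentiable_projection[OF A P]
  have p: "?p \<xi> \<in> ?S" for \<xi> by (rule differential_in_tangent_space[OF TA A' \<pi> Pc])
  note p_lin = differential_linear[OF \<pi> Pc]
  have Kfib: "\<forall>\<xi>\<in>?T. fst (K (P, \<xi>)) = fst P \<and>
      (\<forall>\<eta>\<in>?T. ?k (\<xi> + \<eta>) = ?k \<xi> + ?k \<eta>) \<and> (\<forall>r. ?k (r *\<^sub>R \<xi>) = r *\<^sub>R ?k \<xi>)"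
    using K P by (simp add: connector_def)
  have k: "?k \<xi> \<in> ?S" if "\<xi> \<in> ?T" for \<xi>
  proof -
    have "K ` tangent_bundle (tangent_atlas A) \<subseteq> tangent_bundle A"
      using K by (auto simp: connector_def smooth_map_on_def carrier_tangent_atlas)
    moreover have "(P, \<xi>) \<in> tangent_bundle (tangent_atlas A)"
      using that Pc by (simp add: tangent_bundle_def[of "tangent_atlas A"])
    ultimately have "K (P, \<xi>) \<in> tangent_bundle A" by blast
    moreover have "fst (K (P, \<xi>)) = fst P" using Kfib that by blast
    ultimately show ?thesis by (auto simp: tangent_bundle_def)
  qed
  have k_add: "?k (\<xi> + \<eta>) = ?k \<xi> + ?k \<eta>" if "\<xi> \<in> ?T" "\<eta> \<in> ?T" for \<xi> \<eta>
    using bspec[OF Kfib that(1)] that(2) by simp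
  have k_scale: "?k (r *\<^sub>R \<xi>) = r *\<^sub>R ?k \<xi>" if "\<xi> \<in> ?T" for r \<xi>
    using bspec[OF Kfib that] by simp
  have sym: "g (fst P) u v = g (fst P) v u" if "u \<in> ?S" "v \<in> ?S" for u v
    using ip that by (auto simp: inner_product_on_def)
  have add: "g (fst P) (u + v) w = g (fst P) u w + g (fst P) v w"
    if "u \<in> ?S" "v \<in> ?S" "w \<in> ?S" for u v w
    using ip that by (auto simp: inner_product_on_def)
  have scale: "g (fst P) (r *\<^sub>R u) v = r * g (fst P) u v" if "u \<in> ?S" "v \<in> ?S" for r u v
    using ip that by (auto simp: inner_product_on_def)
  have pos: "g (fst P) u u > 0" if "u \<in> ?S" "u \<noteq> 0" for u
    using ip that by (auto simp: inner_product_on_def)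
  have nonneg: "g (fst P) u u \<ge> 0" if "u \<in> ?S" for u
    using pos[OF that] scale[OF that that, of 0] by (cases "u = 0") auto
  show ?thesis
    unfolding inner_product_on_def sasaki_metric_def
  proof (intro conjI ballI allI impI)
    fix \<xi> assume \<xi>: "\<xi> \<in> ?T" "\<xi> \<noteq> 0"
    show "g (fst P) (?p \<xi>) (?p \<xi>) + g (fst P) (?k \<xi>) (?k \<xi>) > 0"
    proof (cases "?p \<xi> = 0")
      case False
      then show ?thesis using pos[OF p] nonneg[OF k[OF \<xi>(1)]] by (simp add: add_pos_nonneg)
    next
      case True
      then obtain w where w: "w \<in> ?S" "\<xi> = vertical_lift A P w"
        using vertical_if_projection_zero[OF A P \<xi>(1)] by blast
      have "K (P, vertical_lift A P w) = (fst P, w)"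
        by (rule K[unfolded connector_def, THEN conjunct2, THEN conjunct2, rule_format, OF P w(1)])
      then have kw: "?k \<xi> = w" by (simp add: w(2))
      have "w \<noteq> 0"
      proof
        assume "w = 0"
        obtain c where c: "c \<in> charts_at A (fst P)" using some_chart_in[OF x] ..
        have "\<xi> (tangent_chart A c) = 0"
          using vertical_lift_coords[OF A P w(1) c] w(2) \<open>w = 0\<close> by (simp add: zero_prod_def)
        then have "\<xi> = 0"
          using c by (intro tangent_space_eqI[OF \<xi>(1) subspace_0[OF subspace_tangent_space[OF TA]],
              of "tangent_chart A c"]) (auto simp: charts_at_tangent_atlas[OF P])
        then show False using \<xi>(2) by simp
      qed
      then show ?thesis
        using pos[OF w(1)] kw nonneg[OF p] by (simp add: add_nonneg_pos)
    qed
  qed (simp_all add: p k p_lin k_add k_scale add scale sym distrib_left)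
qed


section \<open>Gradients of sums of squares\<close>

lemma fiber_valued_derivative:
  assumes A: "differentiable_atlas A"
    and f: "differentiable_map_at B (fiber_atlas A y) f p"
    and fp: "f p \<in> tangent_space A y" and c: "c \<in> charts_at A y" and C: "C \<in> charts_at B p"
  shows "((\<lambda>z. f (chart_inv C z) c) has_derivative
            frechet_derivative (\<lambda>z. f (chart_inv C z) c) (at (snd C p))) (at (snd C p))"
    and "\<forall>\<^sub>F z in nhds (snd C p). f (chart_inv C z) \<in> tangent_space A y"
proof -
  have c': "(tangent_space A y, \<lambda>v. v c) \<in> charts_at (fiber_atlas A y) (f p)"
    using c by (auto simp: charts_at_fiber_atlas[OF fp])
  show "((\<lambda>z. f (chart_inv C z) c) has_derivative
            frechet_derivative (\<lambda>z. f (chart_inv C z) c) (at (snd C p))) (at (snd C p))"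
    using differentiable_map_atD(2)[OF f C c'] by (simp add: frechet_derivative_works o_def)
  show "\<forall>\<^sub>F z in nhds (snd C p). f (chart_inv C z) \<in> tangent_space A y"
    using differentiable_map_atD(1)[OF f C c'] by simp
qed

lemma fiber_valued_differential:
  assumes B: "differentiable_atlas B" and A: "differentiable_atlas A"
    and f: "differentiable_map_at B (fiber_atlas A y) f p" and p: "p \<in> carrier B"
    and fp: "f p \<in> tangent_space A y" and c: "c \<in> charts_at A y" and C: "C = some_chart B p"
  shows "of_fiber_tangent A y (differential B (fiber_atlas A y) f p \<xi>) =
           vector_of_coords A c y
             (frechet_derivative (\<lambda>z. f (chart_inv C z) c) (at (snd C p)) (\<xi> C))"
proof -
  have "(tangent_space A y, \<lambda>v. v c) \<in> charts_at (fiber_atlas A y) (f p)"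
    using c by (auto simp: charts_at_fiber_atlas[OF fp])
  then show ?thesis
    using of_fiber_tangent[OF A c fp
        differential_in_tangent_space[OF B differentiable_atlas_fiber_atlas[OF A] f p]]
    by (simp add: differential_def C Let_def o_def)
qed

lemma bounded_bilinear_coords:
  assumes A: "differentiable_atlas A" and c: "c \<in> charts_at A y"
    and ip: "inner_product_on (tangent_space A y) (g y)"
  shows "bounded_bilinear (\<lambda>a b. g y (vector_of_coords A c y a) (vector_of_coords A c y b))"
proof -
  let ?\<phi> = "vector_of_coords A c y"
  note \<phi> = vector_of_coords(1)[OF A c] and lin = linear_vector_of_coords[OF A c]
  have left: "linear (\<lambda>a. g y (?\<phi> a) (?\<phi> b))" for b
    using ip by (intro linearI)
      (simp_all add: linear_add[OF lin] linear_scale[OF lin] inner_product_on_def \<phi>)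
  have "g y (?\<phi> a) (?\<phi> b) = g y (?\<phi> b) (?\<phi> a)" for a b
    using ip \<phi> by (auto simp: inner_product_on_def)
  then have "linear (\<lambda>b. g y (?\<phi> a) (?\<phi> b))" for a
    using left[of a] by (simp cong: if_cong)
  with left show ?thesis
    by (simp add: bilinear_conv_bounded_bilinear[symmetric] bilinear_def)
qed

lemma has_derivative_metric_square:
  assumes A: "differentiable_atlas A" and B: "differentiable_atlas B"
    and ip: "inner_product_on (tangent_space A y) (g y)"
    and f: "differentiable_map_at B (fiber_atlas A y) f p"
    and fp: "f p \<in> tangent_space A y" and c: "c \<in> charts_at A y" and C: "C \<in> charts_at B p"
  shows "((\<lambda>z. g y (f (chart_inv C z)) (f (chart_inv C z))) has_derivative
           (\<lambda>a. 2 * g y (f p) (vector_of_coords A c y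
             (frechet_derivative (\<lambda>z. f (chart_inv C z) c) (at (snd C p)) a)))) (at (snd C p))"
proof -
  let ?\<phi> = "vector_of_coords A c y" and ?H = "\<lambda>z. f (chart_inv C z) c"
  let ?H' = "frechet_derivative ?H (at (snd C p))"
  have p: "chart_inv C (snd C p) = p" using C by (auto simp: charts_at_def chart_inv_chart[OF B])
  have \<phi>p: "?\<phi> (f p c) = f p" by (rule vector_of_coords_coords[OF A c fp])
  note H = fiber_valued_derivative[OF A f fp c C]
  have sym: "g y (?\<phi> a) (f p) = g y (f p) (?\<phi> a)" for a
    using ip fp vector_of_coords(1)[OF A c] by (auto simp: inner_product_on_def)
  have "((\<lambda>z. g y (?\<phi> (?H z)) (?\<phi> (?H z))) has_derivative
      (\<lambda>a. 2 * g y (f p) (?\<phi> (?H' a)))) (at (snd C p))"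
    using bounded_bilinear.FDERIV[OF bounded_bilinear_coords[where g = g, OF A c ip] H(1) H(1)]
    by (simp add: p \<phi>p sym)
  then show ?thesis
    by (rule has_derivative_cong_nhds)
      (rule eventually_mono[OF H(2)], simp add: vector_of_coords_coords[OF A c])
qed

text \<open>
  Differentiating \<open>1/2 \<parallel>f\<parallel>\<^sup>2\<close> gives \<open>\<langle>f, df \<xi>\<rangle> = \<langle>(df)\<^sup>* f, \<xi>\<rangle>\<close>. The inner products on the
  targets are constant since each \<open>f i\<close> takes values in the single tangent space at \<open>y i\<close>.
\<close>

lemma gradient_sum_of_squares:
  fixes A :: "('a, 'e::euclidean_space) chart set" and B :: "('b, 'f::euclidean_space) chart set"
    and I :: "'i set"
  assumes B: "differentiable_atlas B" and p: "p \<in> carrier B"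
    and G: "inner_product_on (tangent_space B p) (G p)"
    and A: "differentiable_atlas A"
    and y: "\<And>i. i \<in> I \<Longrightarrow> y i \<in> carrier A"
    and ip: "\<And>i. i \<in> I \<Longrightarrow> inner_product_on (tangent_space A (y i)) (g (y i))"
    and f: "\<And>i. i \<in> I \<Longrightarrow> differentiable_map_at B (fiber_atlas A (y i)) (f i) p"
    and fp: "\<And>i. i \<in> I \<Longrightarrow> f i p \<in> tangent_space A (y i)"
  shows "gradient B G (\<lambda>q. 1 / 2 * (\<Sum>i\<in>I. g (y i) (f i q) (f i q))) p =
    (\<Sum>i\<in>I. adjoint_on (tangent_space B p) (G p) (tangent_space A (y i)) (g (y i))
       (\<lambda>\<xi>. of_fiber_tangent A (y i) (differential B (fiber_atlas A (y i)) (f i) p \<xi>)) (f i p))"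
proof -
  define C where "C = some_chart B p"
  have C: "C \<in> charts_at B p" using some_chart_in[OF p] by (simp add: C_def)
  let ?T = "tangent_space B p" and ?\<phi> = "vector_of_coords B C p"
  define c where "c i = some_chart A (y i)" for i
  have c: "c i \<in> charts_at A (y i)" if "i \<in> I" for i
    using some_chart_in[OF y[OF that]] by (simp add: c_def)
  define df where "df i \<xi> = of_fiber_tangent A (y i)
    (differential B (fiber_atlas A (y i)) (f i) p \<xi>)" for i \<xi>
  define H' where "H' i = frechet_derivative (\<lambda>z. f i (chart_inv C z) (c i)) (at (snd C p))" for i
  have df: "df i \<xi> = vector_of_coords A (c i) (y i) (H' i (\<xi> C))" if "i \<in> I" for i \<xi>
    unfolding df_def H'_def
    by (rule fiber_valued_differential[OF B A f[OF that] p fp[OF that] c[OF that] C_def])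
  have represents: "\<exists>!v. v \<in> ?T \<and> (\<forall>\<xi>\<in>?T. G p v \<xi> = L (\<xi> C))" if L: "linear L" for L :: "'f \<Rightarrow> real"
    by (rule inner_product_on_represents[OF G linear_vector_of_coords[OF B C]
          bij_betw_vector_of_coords[OF B C]])
      (simp add: vector_of_coords(2)[OF B C] L)
  define a where "a i = adjoint_on ?T (G p) (tangent_space A (y i)) (g (y i)) (df i) (f i p)" for i
  have a: "a i \<in> ?T \<and> (\<forall>\<xi>\<in>?T. G p (a i) \<xi> = g (y i) (f i p) (df i \<xi>))" if i: "i \<in> I" for i
  proof -
    let ?\<psi> = "vector_of_coords A (c i) (y i)"
    have "linear (\<lambda>b. g (y i) (?\<psi> (f i p (c i))) (?\<psi> b))"
      by (rule bounded_linear.linear[OF bounded_bilinear.bounded_linear_right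
            [OF bounded_bilinear_coords[where g = g, OF A c[OF i] ip[OF i]]]])
    moreover have "linear (H' i)"
      unfolding H'_def
      by (rule has_derivative_linear[OF fiber_valued_derivative(1)[OF A f[OF i] fp[OF i] c[OF i] C]])
    ultimately have "linear (\<lambda>b. g (y i) (?\<psi> (f i p (c i))) (?\<psi> (H' i b)))"
      using linear_compose[of "H' i" "\<lambda>b. g (y i) (?\<psi> (f i p (c i))) (?\<psi> b)"] by (simp add: o_def)
    from theI'[OF represents[OF this]] show ?thesis
      by (simp add: a_def adjoint_on_def fp[OF i] df[OF i] vector_of_coords_coords[OF A c[OF i] fp[OF i]])
  qed
  have sum_in: "(\<Sum>i\<in>I. a i) \<in> ?T"
    using a by (intro subspace_sum[OF subspace_tangent_space[OF B]]) auto
  have G_sum: "G p (\<Sum>i\<in>I. a i) \<xi> = (\<Sum>i\<in>I. g (y i) (f i p) (df i \<xi>))" if \<xi>: "\<xi> \<in> ?T" for \<xi>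
  proof -
    interpret \<beta>: bounded_bilinear "\<lambda>u v. G p (?\<phi> u) (?\<phi> v)"
      by (rule bounded_bilinear_coords[where g = G, OF B C G])
    have "G p (\<Sum>i\<in>I. a i) \<xi> = G p (?\<phi> (\<Sum>i\<in>I. a i C)) (?\<phi> (\<xi> C))"
    proof -
      have "?\<phi> (\<Sum>i\<in>I. a i C) = (\<Sum>i\<in>I. ?\<phi> (a i C))"
        by (rule linear_sum[OF linear_vector_of_coords[OF B C]])
      also have "\<dots> = (\<Sum>i\<in>I. a i)"
        using a by (intro sum.cong) (auto simp: vector_of_coords_coords[OF B C])
      finally show ?thesis by (simp add: vector_of_coords_coords[OF B C \<xi>])
    qed
    also have "\<dots> = (\<Sum>i\<in>I. G p (?\<phi> (a i C)) (?\<phi> (\<xi> C)))" by (rule \<beta>.sum_left)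
    also have "\<dots> = (\<Sum>i\<in>I. g (y i) (f i p) (df i \<xi>))"
      using a \<xi> by (intro sum.cong) (auto simp: vector_of_coords_coords[OF B C])
    finally show ?thesis .
  qed
  define F where "F q = 1 / 2 * (\<Sum>i\<in>I. g (y i) (f i q) (f i q))" for q
  have "((F \<circ> chart_inv C) has_derivative (\<lambda>b. 1 / 2 * (\<Sum>i\<in>I. 2 * g (y i) (f i p)
      (vector_of_coords A (c i) (y i) (H' i b))))) (at (snd C p))"
    unfolding F_def o_def H'_def
    by (intro has_derivative_mult_right has_derivative_sum)
      (rule has_derivative_metric_square[where g = g and f = "f i" and y = "y i" and c = "c i" for i, OF A B ip f fp c C], assumption+)
  from frechet_derivative_at[OF this, symmetric]
  have dF: "function_differential B F p \<xi> = (\<Sum>i\<in>I. g (y i) (f i p) (df i \<xi>))" for \<xi>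
    by (simp add: function_differential_def Let_def C_def[symmetric] sum_distrib_left df)
  have lin: "linear (\<lambda>b. frechet_derivative (F \<circ> chart_inv C) (at (snd C p)) b)"
    using \<open>((F \<circ> chart_inv C) has_derivative _) _\<close>
    by (intro linear_frechet_derivative) (auto simp: differentiable_def)
  have "gradient B G F p = (\<Sum>i\<in>I. a i)"
    unfolding gradient_def
  proof (rule the1_equality)
    show "\<exists>!w. w \<in> ?T \<and> (\<forall>\<xi>\<in>?T. G p w \<xi> = function_differential B F p \<xi>)"
      using represents[OF lin] by (simp add: function_differential_def Let_def C_def[symmetric])
    show "(\<Sum>i\<in>I. a i) \<in> ?T \<and> (\<forall>\<xi>\<in>?T. G p (\<Sum>i\<in>I. a i) \<xi> = function_differential B F p \<xi>)"
      using sum_in G_sum dF by simp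
  qed
  moreover have "F = (\<lambda>q. 1 / 2 * (\<Sum>i\<in>I. g (y i) (f i q) (f i q)))"
    by (simp add: F_def fun_eq_iff)
  moreover have "df i = (\<lambda>\<xi>. of_fiber_tangent A (y i)
      (differential B (fiber_atlas A (y i)) (f i) p \<xi>))" for i
    by (simp add: df_def fun_eq_iff)
  ultimately show ?thesis by (simp add: a_def)
qed


section \<open>The least-squares functional of a retraction\<close>

lemma differentiable_h_map:
  assumes A: "smooth_atlas A" and R: "manifold_retraction A R" and y: "y \<in> carrier A"
    and diffeo: "diffeomorphism_on (fiber_atlas A y) U A D (\<lambda>v. R (y, v))"
    and P: "P \<in> V_dom A R t D"
  shows "differentiable_map_at (tangent_atlas A) (fiber_atlas A y) (h_map R t y U) P"
    and "h_map R t y U P \<in> tangent_space A y"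
proof -
  have A': "differentiable_atlas A" using A by (rule smooth_atlas_imp_differentiable_atlas)
  note TA = differentiable_atlas_tangent_atlas[OF A]
  note fib = differentiable_atlas_fiber_atlas[OF A']
  let ?Rinv = "the_inv_into U (\<lambda>v. R (y, v))"
  have h: "h_map R t y U = ?Rinv \<circ> (R \<circ> fiber_scale t)"
    by (auto simp: h_map_def fiber_scale_def fun_eq_iff)
  have PT: "P \<in> tangent_bundle A" and RD: "R (fiber_scale t P) \<in> D"
    using P by (auto simp: V_dom_def fiber_scale_def)
  have tP: "fiber_scale t P \<in> tangent_bundle A"
    using PT subspace_scale[OF subspace_tangent_space[OF A']]
    by (auto simp: fiber_scale_def tangent_bundle_def)
  have R': "smooth_map_on (tangent_atlas A) (tangent_bundle A) A R"
    using R by (simp add: manifold_retraction_def)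
  have Rinv: "smooth_map_on A D (fiber_atlas A y) ?Rinv"
    using diffeo by (simp add: diffeomorphism_on_def)
  have "differentiable_map_at (tangent_atlas A) A (R \<circ> fiber_scale t) P"
    by (rule differentiable_map_at_compose[OF TA TA differentiable_fiber_scale[OF A PT]
          smooth_map_on_imp_differentiable_map_at[OF TA A' R' tP]])
      (simp add: carrier_tangent_atlas tP)
  moreover have "differentiable_map_at A (fiber_atlas A y) ?Rinv ((R \<circ> fiber_scale t) P)"
    using RD by (intro smooth_map_on_imp_differentiable_map_at[OF A' fib Rinv]) simp
  moreover have "(R \<circ> fiber_scale t) P \<in> carrier A"
    using R' tP by (auto simp: smooth_map_on_def)
  ultimately show "differentiable_map_at (tangent_atlas A) (fiber_atlas A y) (h_map R t y U) P"
    unfolding h by (rule differentiable_map_at_compose[OF TA A'])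
  have "?Rinv ` D \<subseteq> tangent_space A y"
    using Rinv by (simp add: smooth_map_on_def carrier_fiber_atlas[OF y])
  then show "h_map R t y U P \<in> tangent_space A y" using RD by (auto simp: h)
qed

theorem mainTheorem3:
  fixes A :: "('a, 'e::euclidean_space) chart set"
    and g :: "('a, 'e) metric"
    and K :: "('a, 'e) connector_map"
    and R :: "('a, 'e) tpoint \<Rightarrow> 'a"
    and m :: nat
    and t :: "nat \<Rightarrow> real"
    and y :: "nat \<Rightarrow> 'a"
    and U :: "nat \<Rightarrow> ('a, 'e) tvec set"
    and D :: "nat \<Rightarrow> 'a set"
    and V :: "('a, 'e) tpoint set"
  assumes "riemannian_manifold A g"
    and "levi_civita_connector A g K"
    and "manifold_retraction A R"
    and "\<forall>i\<in>{1..m}. y i \<in> carrier A"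
    and "\<forall>i\<in>{1..m}. openin (atlas_topology (fiber_atlas A (y i))) (U i)"
    and "\<forall>i\<in>{1..m}. openin (atlas_topology A) (D i)"
    and "\<forall>i\<in>{1..m}. diffeomorphism_on (fiber_atlas A (y i)) (U i) A (D i) (\<lambda>v. R (y i, v))"
    and "V = tangent_bundle A \<inter> (\<Inter>i\<in>{1..m}. V_dom A R (t i) (D i))"
  shows "\<forall>P\<in>V.
    gradient (tangent_atlas A) (sasaki_metric A g K) (F_fun g R m t y U) P
      = (\<Sum>i = 1..m.
          adjoint_on (tangent_space (tangent_atlas A) P) (sasaki_metric A g K P)
            (tangent_space A (y i)) (g (y i))
            (dh_map A R (t i) (y i) (U i) P)
            (h_map R (t i) (y i) (U i) P))"
proof
  fix P assume PV: "P \<in> V"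
  have A: "smooth_atlas A"
    using assms(1) by (auto simp: riemannian_manifold_def smooth_manifold_def)
  have A': "differentiable_atlas A" using A by (rule smooth_atlas_imp_differentiable_atlas)
  have P: "P \<in> tangent_bundle A" and Pi: "\<And>i. i \<in> {1..m} \<Longrightarrow> P \<in> V_dom A R (t i) (D i)"
    using PV assms(8) by auto
  have K: "connector A K" using assms(2) by (simp add: levi_civita_connector_def)
  have F: "F_fun g R m t y U = (\<lambda>Q. 1 / 2 * (\<Sum>i = 1..m.
      g (y i) (h_map R (t i) (y i) (U i) Q) (h_map R (t i) (y i) (U i) Q)))"
    by (simp add: F_fun_def fun_eq_iff)
  have dh: "dh_map A R (t i) (y i) (U i) P = (\<lambda>\<xi>. of_fiber_tangent A (y i)
      (differential (tangent_atlas A) (fiber_atlas A (y i)) (h_map R (t i) (y i) (U i)) P \<xi>))" for i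
    by (simp add: dh_map_def fun_eq_iff)
  show "gradient (tangent_atlas A) (sasaki_metric A g K) (F_fun g R m t y U) P
      = (\<Sum>i = 1..m.
          adjoint_on (tangent_space (tangent_atlas A) P) (sasaki_metric A g K P)
            (tangent_space A (y i)) (g (y i))
            (dh_map A R (t i) (y i) (U i) P)
            (h_map R (t i) (y i) (U i) P))"
    unfolding F dh
  proof (rule gradient_sum_of_squares[where G = "sasaki_metric A g K", OF differentiable_atlas_tangent_atlas[OF A] _
        inner_product_on_sasaki_metric[OF assms(1) K P] A'])
    show "P \<in> carrier (tangent_atlas A)" using P by (simp add: carrier_tangent_atlas)
    fix i assume i: "i \<in> {1..m}"
    show y: "y i \<in> carrier A" using assms(4) i by blast
    show "inner_product_on (tangent_space A (y i)) (g (y i))"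
      using assms(1) y by (simp add: riemannian_manifold_def)
    have diffeo: "diffeomorphism_on (fiber_atlas A (y i)) (U i) A (D i) (\<lambda>v. R (y i, v))"
      using assms(7) i by blast
    show "differentiable_map_at (tangent_atlas A) (fiber_atlas A (y i)) (h_map R (t i) (y i) (U i)) P"
      and "h_map R (t i) (y i) (U i) P \<in> tangent_space A (y i)"
      by (rule differentiable_h_map[OF A assms(3) y diffeo Pi[OF i]])+
  qed
qed

end
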